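(* Let $K$ be a semi-Eberlein compact space. (1) If $L$ is an open continuous image of $K$ (i.e. there is a continuous open surjection $K\to L$) and $L$ has densely many $G_\delta$-points, then $L$ is semi-Eberlein. (2) If $K$ is moreover Corson and $L$ is a continuous image of $K$, then $L$ is semi-Eberlein.
   Context: All topological spaces are Tychonoff (in particular Hausdorff). For a set $I$, $c_0(I)=\{x\in\mathbb{R}^I : \forall \varepsilon>0,\ \{i\in I: |x(i)|>\varepsilon\}\text{ is finite}\}$ and $\Sigma(I)=\{x\in\mathbb{R}^I: \{i\in I: x(i)\ne 0\}\text{ is countable}\}$, both considered as subspaces of $\mathbb{R}^I$ with the product topology. A compact space $K$ is semi-Eberlein if there is a homeomorphic embedding $h:K\to\mathbb{R}^I$, for some set $I$, such that $h^{-1}[c_0(I)]$ is dense in $K$. A compact space is Corson if it embeds homeomorphically into $\Sigma(I)$ for some set $I$. A $G_\delta$-point of $L$ is a point $x$ such that $\{x\}$ is a $G_\delta$ set in $L$. *)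

theory Defs
  imports "HOL-Analysis.Analysis"
begin

definition tychonoff_space :: "'a topology \<Rightarrow> bool" where
  "tychonoff_space X \<longleftrightarrow> completely_regular_space X \<and> Hausdorff_space X"

definition c0_set :: "'i set \<Rightarrow> ('i \<Rightarrow> real) set" where
  "c0_set I = {x \<in> topspace (powertop_real I). \<forall>\<epsilon>>0. finite {i \<in> I. \<bar>x i\<bar> > \<epsilon>}}"

definition Sigma_set :: "'i set \<Rightarrow> ('i \<Rightarrow> real) set" where
  "Sigma_set I = {x \<in> topspace (powertop_real I). countable {i \<in> I. x i \<noteq> 0}}"

definition dense_in :: "'a topology \<Rightarrow> 'a set \<Rightarrow> bool" where
  "dense_in X S \<longleftrightarrow> S \<subseteq> topspace X \<and> X closure_of S = topspace X"

text \<open>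
  HOL cannot quantify over types inside a formula, so in the two definitions below the existentially
  quantified index set I ranges over the sets of real-valued functions on the points of the space.
  This is no restriction: an index can be identified with the corresponding coordinate
  function of the embedding. The lemmas \<open>semi_EberleinI\<close> and \<open>corsonI\<close> show that an
  embedding with index set of an arbitrary type is good enough.
\<close>

definition semi_Eberlein :: "'a topology \<Rightarrow> bool" where
  "semi_Eberlein X \<longleftrightarrow> compact_space X \<and>
     (\<exists>(I :: ('a \<Rightarrow> real) set) h. embedding_map X (powertop_real I) h \<and>
        dense_in X {x \<in> topspace X. h x \<in> c0_set I})"

definition corson :: "'a topology \<Rightarrow> bool" where
  "corson X \<longleftrightarrow> compact_space X \<and>
     (\<exists>(I :: ('a \<Rightarrow> real) set) h.
        embedding_map X (subtopology (powertop_real I) (Sigma_set I)) h)"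

lemma coordinate_reindex:
  fixes h :: "'a \<Rightarrow> 'i \<Rightarrow> real" and I :: "'i set"
  assumes "compact_space X" and emb: "embedding_map X (powertop_real I) h"
  obtains J :: "('a \<Rightarrow> real) set" and g where
    "embedding_map X (powertop_real J) g"
    "\<And>x. x \<in> topspace X \<Longrightarrow> h x \<in> c0_set I \<Longrightarrow> g x \<in> c0_set J"
    "\<And>x. x \<in> topspace X \<Longrightarrow> h x \<in> Sigma_set I \<Longrightarrow> g x \<in> Sigma_set J"
proof -
  define c where "c = (\<lambda>i x. h x i)"
  define J where "J = c ` I"
  define g where "g = (\<lambda>x. restrict (\<lambda>f. f x) J)"
  have cont: "continuous_map X (powertop_real I) h"
    using emb unfolding embedding_map_def
    by (blast dest: homeomorphic_imp_continuous_map continuous_map_into_fulltopology)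
  have inj: "inj_on h (topspace X)"
    using emb by (simp add: embedding_map_def homeomorphic_map_def)
  have hI: "h x \<in> extensional I" if "x \<in> topspace X" for x
    using cont that by (auto simp: continuous_map_def PiE_def)
  have gJ: "g x \<in> topspace (powertop_real J)" for x
    by (simp add: g_def)
  have "continuous_map X (powertop_real J) g"
    using cont
    by (auto simp: continuous_map_componentwise g_def J_def c_def)
  moreover have "inj_on g (topspace X)"
  proof (rule inj_onI)
    fix x y assume xy: "x \<in> topspace X" "y \<in> topspace X" and eq: "g x = g y"
    have "h x i = h y i" if "i \<in> I" for i
      using fun_cong[OF eq, of "c i"] that by (simp add: g_def J_def c_def)
    then have "h x = h y"
      using hI xy by (meson extensionalityI)
    then show "x = y"
      using inj xy by (simp add: inj_on_eq_iff)
  qed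
  ultimately have 1: "embedding_map X (powertop_real J) g"
    using \<open>compact_space X\<close>
    by (intro continuous_imp_embedding_map) (auto simp: Hausdorff_space_product_topology)
  have 2: "g x \<in> c0_set J" if "h x \<in> c0_set I" for x
  proof -
    have "finite {f \<in> J. \<bar>g x f\<bar> > \<epsilon>}" if "\<epsilon> > 0" for \<epsilon>
    proof (rule finite_subset)
      show "{f \<in> J. \<bar>g x f\<bar> > \<epsilon>} \<subseteq> c ` {i \<in> I. \<bar>h x i\<bar> > \<epsilon>}"
        by (auto simp: g_def J_def c_def)
      show "finite (c ` {i \<in> I. \<bar>h x i\<bar> > \<epsilon>})"
        using that \<open>h x \<in> c0_set I\<close> by (auto simp: c0_set_def)
    qed
    then show ?thesis
      using gJ by (simp add: c0_set_def)
  qed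
  have 3: "g x \<in> Sigma_set J" if "h x \<in> Sigma_set I" for x
  proof -
    have "countable {f \<in> J. g x f \<noteq> 0}"
    proof (rule countable_subset)
      show "{f \<in> J. g x f \<noteq> 0} \<subseteq> c ` {i \<in> I. h x i \<noteq> 0}"
        by (auto simp: g_def J_def c_def)
      show "countable (c ` {i \<in> I. h x i \<noteq> 0})"
        using that by (auto simp: Sigma_set_def)
    qed
    then show ?thesis
      using gJ by (simp add: Sigma_set_def)
  qed
  show thesis
    using 1 2 3 that by blast
qed

lemma semi_EberleinI:
  fixes h :: "'a \<Rightarrow> 'i \<Rightarrow> real" and I :: "'i set"
  assumes "compact_space X" and "embedding_map X (powertop_real I) h"
    and dense: "dense_in X {x \<in> topspace X. h x \<in> c0_set I}"
  shows "semi_Eberlein X"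
proof -
  obtain J :: "('a \<Rightarrow> real) set" and g where g: "embedding_map X (powertop_real J) g"
    "\<And>x. x \<in> topspace X \<Longrightarrow> h x \<in> c0_set I \<Longrightarrow> g x \<in> c0_set J"
    using coordinate_reindex[OF assms(1,2)] by metis
  have "X closure_of {x \<in> topspace X. h x \<in> c0_set I} \<subseteq>
        X closure_of {x \<in> topspace X. g x \<in> c0_set J}"
    using g by (intro closure_of_mono) auto
  then have "dense_in X {x \<in> topspace X. g x \<in> c0_set J}"
    using dense closure_of_subset_topspace unfolding dense_in_def by fastforce
  then show ?thesis
    using assms(1) g(1) unfolding semi_Eberlein_def by blast
qed

lemma corsonI:
  fixes h :: "'a \<Rightarrow> 'i \<Rightarrow> real" and I :: "'i set"
  assumes "compact_space X"
    and "embedding_map X (subtopology (powertop_real I) (Sigma_set I)) h"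
  shows "corson X"
proof -
  have h: "embedding_map X (powertop_real I) h" "h ` topspace X \<subseteq> Sigma_set I"
    using assms(2) by (auto simp: embedding_map_in_subtopology)
  obtain J :: "('a \<Rightarrow> real) set" and g where "embedding_map X (powertop_real J) g"
    "\<And>x. x \<in> topspace X \<Longrightarrow> h x \<in> Sigma_set I \<Longrightarrow> g x \<in> Sigma_set J"
    using coordinate_reindex[OF assms(1) h(1)] by metis
  then have "embedding_map X (subtopology (powertop_real J) (Sigma_set J)) g"
    using h(2) by (auto simp: embedding_map_in_subtopology)
  then show ?thesis
    using assms(1) unfolding corson_def by blast
qed

end

theory Submission
  imports Defs
begin

text \<open>
  Embed \<open>K\<close> in a cube so that \<open>K \<inter> c\<^sub>0(I)\<close> is dense, and let \<open>f\<close> map \<open>K\<close> onto \<open>L\<close>. In both cases the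
  pairs of points with countable support are dense in \<open>{(x, y). f x = f y}\<close>. A closing-off argument
  then shows that the coordinate truncations \<open>r\<^sub>M\<close> map \<open>K\<close> to itself and respect the fibres of \<open>f\<close>
  whenever \<open>M\<close> is closed under a suitable finitary operation with countable values.

  By induction on the cardinality of a generating set of \<open>M\<close> one builds a family of fibre-invariant
  continuous functions that separates the fibres meeting \<open>r\<^sub>M(K)\<close>. In the uncountable case, \<open>M\<close> is the
  union of a continuous chain of smaller closed sets \<open>M\<^sub>\<alpha>\<close>, and the functions
  \<open>u \<circ> r\<^bsub>M\<^sub>\<alpha>\<^sub>+\<^sub>1\<^esub> - u \<circ> r\<^bsub>M\<^sub>\<alpha>\<^esub>\<close> are used. For \<open>d \<in> c\<^sub>0\<close> the truncations \<open>r\<^bsub>M\<^sub>\<alpha>\<^sub>+\<^sub>1\<^esub> d\<close> and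
  \<open>r\<^bsub>M\<^sub>\<alpha>\<^esub> d\<close> are uniformly close except for finitely many \<open>\<alpha>\<close>. Splitting the family into countably
  many classes by the modulus of uniform continuity of \<open>u\<close>, only finitely many members of each class
  exceed \<open>\<epsilon>\<close> at \<open>d\<close>. Soft thresholding and scaling turn such a family into an embedding of \<open>L\<close> that
  sends \<open>f(K \<inter> c\<^sub>0(I))\<close> into \<open>c\<^sub>0\<close>.
\<close>

subsection \<open>Products of metric spaces\<close>

lemma open_fun_box:
  fixes U :: "('i \<Rightarrow> 'v::metric_space) set"
  assumes "open U" "x \<in> U"
  obtains F \<delta> where "finite F" "\<delta> > 0" "{y. \<forall>i\<in>F. dist (y i) (x i) < \<delta>} \<subseteq> U"
proof -
  obtain X where X: "x \<in> (\<Pi>\<^sub>E i\<in>UNIV. X i)" "\<And>i. open (X i)" "finite {i. X i \<noteq> UNIV}"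
      "(\<Pi>\<^sub>E i\<in>UNIV. X i) \<subseteq> U"
    using product_topology_open_contains_basis[of "\<lambda>_. euclidean" UNIV U x] assms
    by (auto simp: open_fun_def)
  define F where "F = {i. X i \<noteq> UNIV}"
  have "finite F" using X(3) by (simp add: F_def)
  have "\<exists>e>0. \<forall>z. dist z (x i) < e \<longrightarrow> z \<in> X i" for i
    using X(1,2) by (auto simp: open_dist PiE_iff)
  then obtain e where e: "\<And>i. e i > 0" "\<And>i z. dist z (x i) < e i \<Longrightarrow> z \<in> X i"
    by metis
  define \<delta> where "\<delta> = Min (insert 1 (e ` F))"
  have "\<delta> > 0" "\<And>i. i \<in> F \<Longrightarrow> \<delta> \<le> e i"
    using \<open>finite F\<close> e(1) by (auto simp: \<delta>_def)
  moreover have "y \<in> U" if "\<forall>i\<in>F. dist (y i) (x i) < \<delta>" for y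
  proof -
    have "y i \<in> X i" for i
    proof (cases "i \<in> F")
      case True
      then show ?thesis
        using that e(2) \<open>\<And>i. i \<in> F \<Longrightarrow> \<delta> \<le> e i\<close> less_le_trans by blast
    qed (auto simp: F_def)
    then show ?thesis using X(4) by auto
  qed
  ultimately show thesis using that \<open>finite F\<close> by blast
qed

lemma open_box:
  fixes x :: "'i \<Rightarrow> 'v::metric_space"
  assumes "finite F"
  shows "open {y. \<forall>i\<in>F. dist (y i) (x i) < \<delta>}"
  using product_topology_basis'[OF assms, of "\<lambda>i. ball (x i) \<delta>" "\<lambda>i. i"]
  by (simp add: dist_commute)

lemma closure_fun_approachable:
  fixes S :: "('i \<Rightarrow> 'v::metric_space) set"
  shows "x \<in> closure S \<longleftrightarrow> (\<forall>F \<delta>. finite F \<and> \<delta> > 0 \<longrightarrow> (\<exists>y\<in>S. \<forall>i\<in>F. dist (y i) (x i) < \<delta>))"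
    (is "_ \<longleftrightarrow> ?R")
proof
  assume x: "x \<in> closure S"
  show ?R
  proof (intro allI impI)
    fix F :: "'i set" and \<delta> :: real assume "finite F \<and> \<delta> > 0"
    then have "open {y. \<forall>i\<in>F. dist (y i) (x i) < \<delta>}" "x \<in> {y. \<forall>i\<in>F. dist (y i) (x i) < \<delta>}"
      by (auto intro: open_box)
    then show "\<exists>y\<in>S. \<forall>i\<in>F. dist (y i) (x i) < \<delta>"
      using x unfolding closure_iff_nhds_not_empty by blast
  qed
next
  assume R: ?R
  show "x \<in> closure S"
    unfolding closure_iff_nhds_not_empty
  proof (intro allI impI)
    fix A V assume V: "V \<subseteq> A" "open V" "x \<in> V"
    obtain F \<delta> where "finite F" "\<delta> > 0" "{y. \<forall>i\<in>F. dist (y i) (x i) < \<delta>} \<subseteq> V"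
      using V(2,3) by (rule open_fun_box)
    moreover from this(1,2) obtain y where "y \<in> S" "\<forall>i\<in>F. dist (y i) (x i) < \<delta>"
      using R by blast
    ultimately show "S \<inter> A \<noteq> {}"
      using V(1) by blast
  qed
qed

lemma compact_imp_closed_fun:
  fixes K :: "('i \<Rightarrow> real) set"
  assumes "compact K" shows "closed K"
proof -
  have "Hausdorff_space (euclidean :: ('i \<Rightarrow> real) topology)"
    unfolding euclidean_product_topology[symmetric] by (simp add: Hausdorff_space_product_topology)
  then show ?thesis
    using compactin_imp_closedin[of euclidean K] assms by simp
qed

lemma closure_fun_approachableD:
  fixes S :: "('i \<Rightarrow> 'v::metric_space) set"
  assumes "x \<in> closure S" "finite F" "\<delta> > 0"
  obtains y where "y \<in> S" "\<And>i. i \<in> F \<Longrightarrow> dist (y i) (x i) < \<delta>"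
  using assms closure_fun_approachable[of x S] by blast

text \<open>Uniform continuity for the product uniformity, whose entourages constrain finitely many
  coordinates. Boxes of half the admissible radius cover \<open>K\<close>; with a finite subcover,
  two close points lie in one full box, where \<open>u\<close> stays within \<epsilon>/2 of its
  value at the centre.\<close>

lemma compact_uniformly_continuous_fun:
  fixes u :: "('i \<Rightarrow> real) \<Rightarrow> real"
  assumes "compact K" "continuous_on K u" "\<epsilon> > 0"
  obtains F \<delta> where "finite F" "\<delta> > 0"
    "\<And>x y. x \<in> K \<Longrightarrow> y \<in> K \<Longrightarrow> \<forall>i\<in>F. \<bar>x i - y i\<bar> < \<delta> \<Longrightarrow> \<bar>u x - u y\<bar> < \<epsilon>"
proof -
  have "\<exists>F \<delta>. finite F \<and> \<delta> > 0 \<and> (\<forall>y\<in>K. (\<forall>i\<in>F. dist (y i) (x i) < 2*\<delta>) \<longrightarrow> \<bar>u y - u x\<bar> < \<epsilon>/2)"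
    if x: "x \<in> K" for x
  proof -
    obtain A where A: "open A" "A \<inter> K = u -` {u x - \<epsilon>/2<..<u x + \<epsilon>/2} \<inter> K"
      using assms(2) unfolding continuous_on_open_invariant by (meson open_greaterThanLessThan)
    then have "x \<in> A" using x assms(3) by auto
    then obtain F \<delta> where F: "finite F" "\<delta> > 0" "{y. \<forall>i\<in>F. dist (y i) (x i) < \<delta>} \<subseteq> A"
      by (rule open_fun_box[OF A(1)])
    have "\<bar>u y - u x\<bar> < \<epsilon>/2" if "y \<in> K" "\<forall>i\<in>F. dist (y i) (x i) < \<delta>" for y
    proof -
      have "y \<in> A \<inter> K" using that F(3) by auto
      then have "u x - \<epsilon>/2 < u y" "u y < u x + \<epsilon>/2" unfolding A(2) by auto
      then show ?thesis by linarith
    qed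
    then show ?thesis using F(1,2) by (intro exI[of _ F] exI[of _ "\<delta>/2"]) auto
  qed
  then obtain F \<delta> where F: "\<And>x. x \<in> K \<Longrightarrow> finite (F x)" "\<And>x. x \<in> K \<Longrightarrow> \<delta> x > 0"
    "\<And>x y. x \<in> K \<Longrightarrow> y \<in> K \<Longrightarrow> \<forall>i\<in>F x. dist (y i) (x i) < 2 * \<delta> x \<Longrightarrow> \<bar>u y - u x\<bar> < \<epsilon>/2"
    by metis
  define B where "B = (\<lambda>x. {y. \<forall>i\<in>F x. dist (y i) (x i) < \<delta> x})"
  have "open (B x)" if "x \<in> K" for x
    unfolding B_def using F(1)[OF that] by (rule open_box)
  moreover have "x \<in> B x" if "x \<in> K" for x
    using F(2)[OF that] by (simp add: B_def)
  then have "K \<subseteq> (\<Union>x\<in>K. B x)" by blast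
  ultimately obtain C where C: "C \<subseteq> K" "finite C" "K \<subseteq> (\<Union>x\<in>C. B x)"
    by (rule compactE_image[OF assms(1)])
  define \<eta> where "\<eta> = Min (insert 1 (\<delta> ` C))"
  have \<eta>: "\<eta> > 0" "\<And>c. c \<in> C \<Longrightarrow> \<eta> \<le> \<delta> c"
    using C(1,2) F(2) by (auto simp: \<eta>_def)
  show thesis
  proof
    show "finite (\<Union>c\<in>C. F c)" using C(1,2) F(1) by auto
    show "\<eta> > 0" by fact
    fix x y assume xy: "x \<in> K" "y \<in> K" "\<forall>i\<in>\<Union>c\<in>C. F c. \<bar>x i - y i\<bar> < \<eta>"
    obtain c where c: "c \<in> C" "\<forall>i\<in>F c. dist (x i) (c i) < \<delta> c"
      using C(3) xy(1) by (auto simp: B_def)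
    have "c \<in> K" using c C by auto
    have "dist (x i) (c i) < 2 * \<delta> c \<and> dist (y i) (c i) < 2 * \<delta> c" if "i \<in> F c" for i
    proof -
      have "\<bar>x i - y i\<bar> < \<delta> c" using xy(3) that c(1) \<eta>(2)[OF c(1)] less_le_trans by blast
      moreover have "dist (x i) (c i) < \<delta> c" using c(2) that by blast
      ultimately show ?thesis unfolding dist_real_def by linarith
    qed
    then have "\<bar>u x - u c\<bar> < \<epsilon>/2" "\<bar>u y - u c\<bar> < \<epsilon>/2"
      using F(3) \<open>c \<in> K\<close> xy by blast+
    then show "\<bar>u x - u y\<bar> < \<epsilon>" by linarith
  qed
qed

subsection \<open>Coordinate truncations\<close>

definition truncate :: "'i set \<Rightarrow> ('i \<Rightarrow> 'v::zero) \<Rightarrow> 'i \<Rightarrow> 'v" where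
  "truncate M x = (\<lambda>i. if i \<in> M then x i else 0)"

lemma truncate_truncate [simp]: "truncate M (truncate N x) = truncate (M \<inter> N) x"
  by (auto simp: truncate_def)

lemma truncate_UNIV [simp]: "truncate UNIV x = x"
  by (simp add: truncate_def)

lemma continuous_on_truncate:
  fixes S :: "('i \<Rightarrow> 'v::{zero, topological_space}) set"
  shows "continuous_on S (truncate M)"
proof (rule continuous_on_coordinatewise_then_product)
  fix i
  show "continuous_on S (\<lambda>x. truncate M x i)"
    using continuous_on_subset[OF continuous_on_product_coordinates[of i], of S]
    by (cases "i \<in> M") (auto simp: truncate_def)
qed

section \<open>Sets of coordinates closed under a finitary set-valued operation\<close>

inductive_set list_closure :: "('i list \<Rightarrow> 'i set) \<Rightarrow> 'i set \<Rightarrow> 'i set" for T X where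
  base: "i \<in> X \<Longrightarrow> i \<in> list_closure T X"
| step: "l \<in> lists (list_closure T X) \<Longrightarrow> i \<in> T l \<Longrightarrow> i \<in> list_closure T X"

definition list_closed :: "('i list \<Rightarrow> 'i set) \<Rightarrow> 'i set \<Rightarrow> bool" where
  "list_closed T M \<longleftrightarrow> (\<forall>l\<in>lists M. T l \<subseteq> M)"

lemma subset_list_closure: "X \<subseteq> list_closure T X"
  by (auto intro: list_closure.base)

lemma list_closed_list_closure: "list_closed T (list_closure T X)"
  by (auto simp: list_closed_def intro: list_closure.step)

lemma list_closure_least:
  assumes "X \<subseteq> M" "list_closed T M" shows "list_closure T X \<subseteq> M"
proof
  fix i assume "i \<in> list_closure T X"
  then show "i \<in> M"
    by induction (use assms in \<open>auto simp: list_closed_def lists_eq_set subset_iff\<close>)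
qed

lemma list_closure_mono: "X \<subseteq> Y \<Longrightarrow> list_closure T X \<subseteq> list_closure T Y"
  by (meson list_closed_list_closure list_closure_least order_trans subset_list_closure)

lemma finite_subset_Union_directed:
  assumes "finite F" "F \<subseteq> \<Union>\<N>" "\<N> \<noteq> {}"
    and "\<And>A B. A \<in> \<N> \<Longrightarrow> B \<in> \<N> \<Longrightarrow> \<exists>C\<in>\<N>. A \<union> B \<subseteq> C"
  shows "\<exists>N\<in>\<N>. F \<subseteq> N"
  using assms(1,2)
proof induction
  case empty then show ?case using assms(3) by auto
next
  case (insert a F)
  then obtain N A where "N \<in> \<N>" "F \<subseteq> N" "A \<in> \<N>" "a \<in> A" by auto
  then show ?case using assms(4)[of N A] by blast
qed

text \<open>A list has finitely many entries, so directedness puts all of them into one member of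
  the family. This is why \<open>T\<close> acts on lists.\<close>

lemma list_closed_Union:
  assumes "\<N> \<noteq> {}" "\<And>A B. A \<in> \<N> \<Longrightarrow> B \<in> \<N> \<Longrightarrow> \<exists>C\<in>\<N>. A \<union> B \<subseteq> C"
    and "\<And>N. N \<in> \<N> \<Longrightarrow> list_closed T N"
  shows "list_closed T (\<Union>\<N>)"
  unfolding list_closed_def
proof
  fix l assume "l \<in> lists (\<Union>\<N>)"
  then obtain N where "N \<in> \<N>" "set l \<subseteq> N"
    using finite_subset_Union_directed[of "set l" \<N>] assms(1,2) by (auto simp: lists_eq_set)
  then show "T l \<subseteq> \<Union>\<N>"
    using assms(3)[of N] by (auto simp: list_closed_def lists_eq_set)
qed

text \<open>Countably many stages are enough: a list over the union of the increasing stages already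
  lies in one of them, and a countable set has only countably many lists.\<close>

lemma countable_list_closure:
  assumes "countable X" "\<And>l. countable (T l)"
  shows "countable (list_closure T X)"
proof -
  define S where "S = rec_nat X (\<lambda>_ A. A \<union> (\<Union>l\<in>lists A. T l))"
  have S: "S 0 = X" "S (Suc n) = S n \<union> (\<Union>l\<in>lists (S n). T l)" for n
    by (simp_all add: S_def)
  have "countable (S n)" for n
    by (induction n) (use assms S in auto)
  moreover have "S m \<subseteq> S n" if "m \<le> n" for m n
    by (rule lift_Suc_mono_le[OF _ that]) (auto simp: S)
  have "list_closed T (\<Union>(range S))"
    unfolding list_closed_def
  proof
    fix l assume l: "l \<in> lists (\<Union>(range S))"
    have "\<exists>N\<in>range S. set l \<subseteq> N"
    proof (rule finite_subset_Union_directed)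
      fix A B assume "A \<in> range S" "B \<in> range S"
      then obtain m n where "A = S m" "B = S n" by auto
      then show "\<exists>C\<in>range S. A \<union> B \<subseteq> C"
        using \<open>\<And>m n. m \<le> n \<Longrightarrow> S m \<subseteq> S n\<close>[of _ "max m n"]
        by (intro bexI[of _ "S (max m n)"]) auto
    qed (use l in \<open>auto simp: lists_eq_set\<close>)
    then obtain n where "set l \<subseteq> S n" by auto
    then have "T l \<subseteq> S (Suc n)" by (auto simp: S lists_eq_set)
    then show "T l \<subseteq> \<Union>(range S)" by blast
  qed
  then have "list_closure T X \<subseteq> \<Union>(range S)"
    using S(1) by (intro list_closure_least) blast+
  ultimately show ?thesis
    by (meson countable_UN countable_subset countableI_type)
qed

section \<open>Truncations that preserve a closed set\<close>

lemma countable_dense_subset: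
  fixes S :: "'a::second_countable_topology set"
  obtains T where "countable T" "T \<subseteq> S" "S \<subseteq> closure T"
proof -
  obtain B :: "'a set set" where B: "countable B" "topological_basis B"
    using ex_countable_basis by auto
  define T where "T = (\<lambda>b. SOME x. x \<in> b \<inter> S) ` {b \<in> B. b \<inter> S \<noteq> {}}"
  have p: "(SOME x. x \<in> b \<inter> S) \<in> b \<inter> S" if "b \<inter> S \<noteq> {}" for b
    using that by (meson ex_in_conv someI_ex)
  show thesis
  proof
    show "countable T" using B(1) by (simp add: T_def)
    show "T \<subseteq> S" using p by (auto simp: T_def)
    show "S \<subseteq> closure T"
    proof
      fix x assume "x \<in> S"
      show "x \<in> closure T"
        unfolding closure_iff_nhds_not_empty
      proof (intro allI impI)
        fix A V assume "V \<subseteq> A" "open V" "x \<in> V"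
        then obtain b where "b \<in> B" "x \<in> b" "b \<subseteq> V"
          using topological_basisE[OF B(2)] by metis
        then have "(SOME x. x \<in> b \<inter> S) \<in> T \<inter> A"
          using p[of b] \<open>x \<in> S\<close> \<open>V \<subseteq> A\<close> by (auto simp: T_def)
        then show "T \<inter> A \<noteq> {}" by blast
      qed
    qed
  qed
qed

text \<open>An explicit form of an elementary submodel argument: \<open>T l\<close> collects the
  supports of countably many points of \<open>D\<close> that approximate all of \<open>D\<close> on
  the coordinates in \<open>l\<close>. The value type is general because the lemma serves both
  single points (\<open>real\<close>) and pairs of points
  (\<open>real \<times> real\<close>).\<close>

lemma truncate_closed_operator:
  fixes X D :: "('i \<Rightarrow> 'v::{zero, metric_space, second_countable_topology}) set"
  assumes "closed X" "D \<subseteq> X" "X \<subseteq> closure D" and supp: "\<And>d. d \<in> D \<Longrightarrow> countable {i. d i \<noteq> 0}"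
  obtains T :: "'i list \<Rightarrow> 'i set" where "\<forall>l. countable (T l)"
    "\<forall>M. list_closed T M \<longrightarrow> (\<forall>x\<in>X. truncate M x \<in> X)"
proof -
  \<comment> \<open>Reads off the coordinates listed in \<open>l\<close>, padded by 0, so that for
    every \<open>l\<close> the restrictions live in the same second countable space of
    sequences.\<close>
  define \<Phi> :: "'i list \<Rightarrow> ('i \<Rightarrow> 'v) \<Rightarrow> nat \<Rightarrow> 'v" where
    "\<Phi> = (\<lambda>l d k. if k < length l then d (l ! k) else 0)"
  have "\<exists>C. countable C \<and> C \<subseteq> D \<and> \<Phi> l ` D \<subseteq> closure (\<Phi> l ` C)" for l
  proof -
    obtain Q where Q: "countable Q" "Q \<subseteq> \<Phi> l ` D" "\<Phi> l ` D \<subseteq> closure Q"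
      by (rule countable_dense_subset)
    then obtain C where "countable C" "C \<subseteq> D" "Q = \<Phi> l ` C"
      using countable_subset_image[of Q "\<Phi> l" D] by blast
    then show ?thesis using Q by blast
  qed
  then obtain C where C: "\<And>l. countable (C l)" "\<And>l. C l \<subseteq> D" "\<And>l. \<Phi> l ` D \<subseteq> closure (\<Phi> l ` C l)"
    by metis
  have approx: "\<exists>c\<in>C l. \<forall>i\<in>set l. dist (c i) (x i) < \<delta>" if xX: "x \<in> X" and \<delta>: "\<delta> > 0" for l x \<delta>
  proof -
    have "x \<in> closure D" using assms(3) xX by blast
    then obtain d where d: "d \<in> D" "\<And>i. i \<in> set l \<Longrightarrow> dist (d i) (x i) < \<delta>/2"
      using closure_fun_approachableD[of x D "set l" "\<delta>/2"] \<delta>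
      by (metis List.finite_set half_gt_zero)
    have "\<Phi> l d \<in> closure (\<Phi> l ` C l)" using C(3) d(1) by blast
    then obtain y where y: "y \<in> \<Phi> l ` C l" "\<And>k. k \<in> {..<length l} \<Longrightarrow> dist (y k) (\<Phi> l d k) < \<delta>/2"
      using closure_fun_approachableD[of "\<Phi> l d" "\<Phi> l ` C l" "{..<length l}" "\<delta>/2"] \<delta>
      by (metis finite_lessThan half_gt_zero)
    then obtain c where c: "c \<in> C l" "y = \<Phi> l c" by blast
    have "dist (c i) (x i) < \<delta>" if i: "i \<in> set l" for i
    proof -
      obtain k where "k < length l" "l ! k = i" using i in_set_conv_nth[of i l] by blast
      then have "dist (c i) (d i) < \<delta>/2" using y(2)[of k] by (simp add: \<Phi>_def c(2))
      moreover have "dist (d i) (x i) < \<delta>/2" using d(2) i by blast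
      ultimately show ?thesis using dist_triangle[of "c i" "x i" "d i"] by linarith
    qed
    then show ?thesis using c(1) by blast
  qed
  \<comment> \<open>If \<open>M\<close> is closed, then on a finite part of \<open>M\<close> the point \<open>x\<close> is approximated by points of \<open>D\<close>
    that vanish outside \<open>M\<close>; these converge to \<open>truncate M x\<close>.\<close>
  define T where "T = (\<lambda>l. \<Union>c\<in>C l. {i. c i \<noteq> 0})"
  show thesis
  proof
    show "\<forall>l. countable (T l)"
      unfolding T_def using C supp by (intro allI countable_UN) blast+
    show "\<forall>M. list_closed T M \<longrightarrow> (\<forall>x\<in>X. truncate M x \<in> X)"
    proof (intro allI impI ballI)
      fix M x assume M: "list_closed T M" and x: "x \<in> X"
      have "truncate M x \<in> closure X"
        unfolding closure_fun_approachable
      proof (intro allI impI, elim conjE)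
        fix F :: "'i set" and \<delta> :: real assume "finite F" "\<delta> > 0"
        then obtain l where l: "set l = F \<inter> M" using finite_list by (metis finite_Int)
        obtain c where c: "c \<in> C l" "\<forall>i\<in>set l. dist (c i) (x i) < \<delta>"
          using approx[OF x \<open>\<delta> > 0\<close>] by blast
        have "T l \<subseteq> M" using M l by (auto simp: list_closed_def lists_eq_set)
        then have "c i = 0" if "i \<notin> M" for i using c(1) that by (auto simp: T_def)
        then have "\<forall>i\<in>F. dist (c i) (truncate M x i) < \<delta>"
          using c(2) l \<open>\<delta> > 0\<close> by (auto simp: truncate_def)
        then show "\<exists>y\<in>X. \<forall>i\<in>F. dist (y i) (truncate M x i) < \<delta>"
          using c(1) C(2) assms(2) by blast
      qed
      then show "truncate M x \<in> X" using assms(1) by simp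
    qed
  qed
qed

subsection \<open>Separating families\<close>

text \<open>\<open>E\<close> will be the fibre relation of the map onto \<open>L\<close>,
  transported to the embedded copy of the compact space. \<open>separated\<close> is what complete
  regularity of \<open>L\<close> becomes after composing functions on \<open>L\<close> with that
  map.\<close>

locale retractive_compact =
  fixes K :: "('i \<Rightarrow> real) set"
    and E :: "('i \<Rightarrow> real) \<Rightarrow> ('i \<Rightarrow> real) \<Rightarrow> bool"
    and T :: "'i list \<Rightarrow> 'i set"
  assumes compact: "compact K"
    and separated: "\<And>x y. x \<in> K \<Longrightarrow> y \<in> K \<Longrightarrow> \<not> E x y \<Longrightarrow>
      \<exists>u. continuous_on K u \<and> (\<forall>a\<in>K. \<forall>b\<in>K. E a b \<longrightarrow> u a = u b) \<and> u x \<noteq> (u y :: real)"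
    and countable_T: "\<And>l. countable (T l)"
    and truncate_K: "\<And>M x. list_closed T M \<Longrightarrow> x \<in> K \<Longrightarrow> truncate M x \<in> K"
    and truncate_E: "\<And>M x y. list_closed T M \<Longrightarrow> x \<in> K \<Longrightarrow> y \<in> K \<Longrightarrow> E x y \<Longrightarrow>
      E (truncate M x) (truncate M y)"
begin

definition invariant :: "(('i \<Rightarrow> real) \<Rightarrow> real) \<Rightarrow> bool" where
  "invariant u \<longleftrightarrow> continuous_on K u \<and> (\<forall>a\<in>K. \<forall>b\<in>K. E a b \<longrightarrow> u a = u b)"

definition c0_points :: "('i \<Rightarrow> real) set" where
  "c0_points = {x \<in> K. \<forall>\<epsilon>>0. finite {i. \<bar>x i\<bar> > \<epsilon>}}"

text \<open>The classes \<open>C n\<close> may depend on \<open>\<epsilon>\<close>. This weak form of being \<open>c\<^sub>0\<close> at the points of \<open>K \<inter> c\<^sub>0\<close>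
  passes through the induction without any rescaling.\<close>

definition sigma_small :: "(('i \<Rightarrow> real) \<Rightarrow> real) set \<Rightarrow> bool" where
  "sigma_small G \<longleftrightarrow> (\<forall>\<epsilon>>0. \<exists>C :: nat \<Rightarrow> _ set. G \<subseteq> (\<Union>n. C n) \<and>
     (\<forall>n. \<forall>d\<in>c0_points. finite {u \<in> C n. \<bar>u d\<bar> > \<epsilon>}))"

lemma sigma_smallE:
  assumes "sigma_small G" "\<epsilon> > 0"
  obtains C :: "nat \<Rightarrow> (('i \<Rightarrow> real) \<Rightarrow> real) set" where "G \<subseteq> (\<Union>n. C n)"
    "\<forall>n. \<forall>d\<in>c0_points. finite {u \<in> C n. \<bar>u d\<bar> > \<epsilon>}"
proof -
  from assms obtain C :: "nat \<Rightarrow> (('i \<Rightarrow> real) \<Rightarrow> real) set" where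
    "G \<subseteq> (\<Union>n. C n) \<and> (\<forall>n. \<forall>d\<in>c0_points. finite {u \<in> C n. \<bar>u d\<bar> > \<epsilon>})"
    unfolding sigma_small_def by presburger
  then show thesis using that[of C] by simp
qed

abbreviation cl :: "'i set \<Rightarrow> 'i set" where "cl \<equiv> list_closure T"

text \<open>Indexed by a generating set \<open>X\<close> rather than by the closed set
  \<open>cl X\<close>, so that initial segments of a well-order of \<open>X\<close> provide the
  smaller instances of the induction. Fibres need to be separated only at truncated points.\<close>

definition adequate :: "'i set \<Rightarrow> (('i \<Rightarrow> real) \<Rightarrow> real) set \<Rightarrow> bool" where
  "adequate X G \<longleftrightarrow> (\<forall>u\<in>G. invariant u) \<and> sigma_small G \<and>
     (\<forall>x\<in>K. \<forall>y\<in>K. (\<forall>u\<in>G. u (truncate (cl X) x) = u (truncate (cl X) y)) \<longrightarrow>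
        E (truncate (cl X) x) (truncate (cl X) y))"

lemma cl_K: "x \<in> K \<Longrightarrow> truncate (cl X) x \<in> K"
  by (simp add: list_closed_list_closure truncate_K)

lemma cl_c0:
  assumes "x \<in> c0_points" shows "truncate (cl X) x \<in> c0_points"
proof -
  have "finite {i. \<bar>truncate (cl X) x i\<bar> > \<epsilon>}" if "\<epsilon> > 0" for \<epsilon>
    by (rule finite_subset[of _ "{i. \<bar>x i\<bar> > \<epsilon>}"])
      (use assms that in \<open>auto simp: c0_points_def truncate_def split: if_splits\<close>)
  then show ?thesis
    using assms cl_K by (simp add: c0_points_def)
qed

lemma continuous_on_comp_truncate_cl:
  "continuous_on K u \<Longrightarrow> continuous_on K (\<lambda>x. u (truncate (cl X) x))"
  by (rule continuous_on_compose2[of K u _ "truncate (cl X)"])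
    (auto simp: cl_K intro: continuous_on_truncate)

lemma invariant_comp_truncate:
  "invariant u \<Longrightarrow> invariant (\<lambda>x. u (truncate (cl X) x))"
  unfolding invariant_def
  using continuous_on_comp_truncate_cl cl_K truncate_E list_closed_list_closure by blast

lemma invariant_diff:
  "invariant u \<Longrightarrow> invariant v \<Longrightarrow> invariant (\<lambda>x. u x - v x)"
  unfolding invariant_def by (auto intro: continuous_on_diff)

text \<open>An invariant function depends, up to \<epsilon>, on finitely many coordinates, and those
  lying in the union lie in one member \<open>N\<close>. Hence a function separating the truncations
  to the union would already separate those to \<open>N\<close>. This carries the chain argument
  through limits.\<close>

lemma E_truncate_Union:
  assumes ne: "\<N> \<noteq> {}" and dir: "\<And>A B. A \<in> \<N> \<Longrightarrow> B \<in> \<N> \<Longrightarrow> \<exists>C\<in>\<N>. A \<union> B \<subseteq> C"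
    and closed: "\<And>N. N \<in> \<N> \<Longrightarrow> list_closed T N" and xy: "x \<in> K" "y \<in> K"
    and E: "\<And>N. N \<in> \<N> \<Longrightarrow> E (truncate N x) (truncate N y)"
  shows "E (truncate (\<Union>\<N>) x) (truncate (\<Union>\<N>) y)"
proof (rule ccontr)
  let ?U = "\<Union>\<N>"
  assume nE: "\<not> ?thesis"
  have "list_closed T ?U"
    using ne dir closed by (rule list_closed_Union)
  then have U: "truncate ?U x \<in> K" "truncate ?U y \<in> K"
    using xy truncate_K by blast+
  obtain u where u: "continuous_on K u" "\<forall>a\<in>K. \<forall>b\<in>K. E a b \<longrightarrow> u a = u b"
    and neq: "u (truncate ?U x) \<noteq> (u (truncate ?U y) :: real)"
    using separated[OF U nE] by blast
  \<comment> \<open>Half the gap: two errors smaller than \<epsilon> cannot bridge it.\<close>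
  define \<epsilon> where "\<epsilon> = \<bar>u (truncate ?U x) - u (truncate ?U y)\<bar> / 2"
  have "\<epsilon> > 0" using neq by (simp add: \<epsilon>_def)
  obtain F \<delta> where F: "finite F" "\<delta> > 0"
    "\<And>x y. x \<in> K \<Longrightarrow> y \<in> K \<Longrightarrow> \<forall>i\<in>F. \<bar>x i - y i\<bar> < \<delta> \<Longrightarrow> \<bar>u x - u y\<bar> < \<epsilon>"
    using compact_uniformly_continuous_fun[OF compact u(1) \<open>\<epsilon> > 0\<close>] by blast
  have "finite (F \<inter> ?U)" using F(1) by simp
  then obtain N where N: "N \<in> \<N>" "F \<inter> ?U \<subseteq> N"
    using finite_subset_Union_directed[OF _ Int_lower2 ne dir] by blast
  have close: "\<bar>u (truncate N z) - u (truncate ?U z)\<bar> < \<epsilon>" if "z \<in> K" for z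
  proof (rule F(3))
    show "truncate N z \<in> K" "truncate ?U z \<in> K"
      using that truncate_K closed[OF N(1)] \<open>list_closed T ?U\<close> by blast+
    show "\<forall>i\<in>F. \<bar>truncate N z i - truncate ?U z i\<bar> < \<delta>"
      using N F(2) by (auto simp: truncate_def)
  qed
  have "u (truncate N x) = u (truncate N y)"
    using u(2) E[OF N(1)] truncate_K closed[OF N(1)] xy by blast
  then have "\<bar>u (truncate ?U x) - u (truncate ?U y)\<bar> \<le>
      \<bar>u (truncate N x) - u (truncate ?U x)\<bar> + \<bar>u (truncate N y) - u (truncate ?U y)\<bar>"
    by linarith
  then show False
    using close[OF xy(1)] close[OF xy(2)] by (simp add: \<epsilon>_def)
qed

section \<open>Adequate families: countable sets, unions of chains, induction on cardinality\<close>

lemma sigma_small_countable: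
  assumes "countable G" shows "sigma_small G"
proof -
  have "G \<subseteq> (\<Union>n. {from_nat_into G n})"
    using subset_range_from_nat_into[OF assms] by auto
  then show ?thesis
    unfolding sigma_small_def
    by (intro allI impI exI[of _ "\<lambda>n. {from_nat_into G n}"]) auto
qed

text \<open>Points supported in a countable set form a space of countable weight, with rational
  boxes as a base. One function is chosen for each pair of boxes that some invariant function
  separates, and these countably many functions separate everything that invariant functions can
  separate there.\<close>

lemma adequate_countable:
  assumes "countable X"
  shows "\<exists>G. adequate X G"
proof -
  let ?M = "cl X"
  have "countable ?M" using assms countable_T by (rule countable_list_closure)
  define box :: "('i \<times> real) list \<times> nat \<Rightarrow> ('i \<Rightarrow> real) set" where
    "box = (\<lambda>(l, n). {x \<in> K. truncate ?M x = x \<and> (\<forall>(i, q)\<in>set l. \<bar>x i - q\<bar> < 1 / Suc n)})"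
  define J where "J = lists (?M \<times> (\<rat> :: real set)) \<times> (UNIV :: nat set)"
  have "countable J"
    unfolding J_def using \<open>countable ?M\<close> countable_rat by (intro countable_SIGMA countable_lists) auto
  have box: "\<exists>a\<in>J. z \<in> box a \<and> (\<forall>x\<in>box a. \<bar>u x - u z\<bar> < \<epsilon>)"
    if z: "z \<in> K" "truncate ?M z = z" and u: "continuous_on K u" and "\<epsilon> > 0" for z \<epsilon> and u :: "('i \<Rightarrow> real) \<Rightarrow> real"
  proof -
    obtain F \<delta> where F: "finite F" "\<delta> > 0"
      "\<And>x y. x \<in> K \<Longrightarrow> y \<in> K \<Longrightarrow> \<forall>i\<in>F. \<bar>x i - y i\<bar> < \<delta> \<Longrightarrow> \<bar>u x - u y\<bar> < \<epsilon>"
      using compact_uniformly_continuous_fun[OF compact u \<open>\<epsilon> > 0\<close>] by blast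
    obtain n where n: "1 / Suc n < \<delta> / 2"
      using F(2) by (metis half_gt_zero inverse_eq_divide reals_Archimedean)
    have "\<exists>q\<in>\<rat>. \<bar>z i - q\<bar> < 1 / Suc n" for i
    proof -
      obtain q where "q \<in> \<rat>" "z i < q" "q < z i + 1 / Suc n"
        using Rats_dense_in_real[of "z i" "z i + 1 / Suc n"] by auto
      then show ?thesis by (intro bexI[of _ q]) auto
    qed
    then obtain q where q: "\<And>i. q i \<in> \<rat>" "\<And>i. \<bar>z i - q i\<bar> < 1 / Suc n" by metis
    obtain l where l: "set l = (\<lambda>i. (i, q i)) ` (F \<inter> ?M)"
      using finite_list[of "(\<lambda>i. (i, q i)) ` (F \<inter> ?M)"] F(1) by auto
    have 1: "(l, n) \<in> J" using l q(1) by (auto simp: J_def lists_eq_set)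
    have 2: "z \<in> box (l, n)" using l q(2) z by (auto simp: box_def)
    have 3: "\<bar>u x - u z\<bar> < \<epsilon>" if x: "x \<in> box (l, n)" for x
    proof (rule F(3))
      show "x \<in> K" "z \<in> K" using x z by (auto simp: box_def)
      show "\<forall>i\<in>F. \<bar>x i - z i\<bar> < \<delta>"
      proof
        fix i assume "i \<in> F"
        show "\<bar>x i - z i\<bar> < \<delta>"
        proof (cases "i \<in> ?M")
          case True
          then have "(i, q i) \<in> set l" using l \<open>i \<in> F\<close> by auto
          then have "\<bar>x i - q i\<bar> < 1 / Suc n" using x by (auto simp: box_def)
          then show ?thesis using q(2)[of i] n by linarith
        next
          case False
          have "truncate ?M x i = x i" using x by (simp add: box_def)
          moreover have "truncate ?M z i = z i" using z by simp
          ultimately show ?thesis using False F(2) by (simp add: truncate_def)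
        qed
      qed
    qed
    show ?thesis using 1 2 3 by blast
  qed
  \<comment> \<open>The common level \<open>s\<close> guarantees that the chosen function, which
    need not be the \<open>u\<close> that was given, still separates every point of one box from
    every point of the other.\<close>
  define sepa where "sepa = (\<lambda>(a, b) u. invariant u \<and> (\<exists>s. (\<forall>x\<in>box a. u x < s) \<and> (\<forall>x\<in>box b. s < u x)))"
  define G where "G = (\<lambda>p. SOME u. sepa p u) ` {p \<in> J \<times> J. \<exists>u. sepa p u}"
  have some: "sepa p (SOME u. sepa p u)" if "sepa p u" for p u
    using that by (rule someI[of "sepa p"])
  have "countable G"
    using \<open>countable J\<close> by (simp add: G_def)
  then have small: "sigma_small G" by (rule sigma_small_countable)
  have inv: "invariant u" if "u \<in> G" for u
    using that some by (fastforce simp: G_def sepa_def)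
  have strict: "\<exists>v\<in>G. v x \<noteq> v y"
    if x: "x \<in> K" "truncate ?M x = x" and y: "y \<in> K" "truncate ?M y = y"
      and u: "invariant u" "u x < u y" for x y u
  proof -
    \<comment> \<open>Half the gap, so that the midpoint \<open>u x + \<epsilon>\<close> serves as
      the level \<open>s\<close>.\<close>
    define \<epsilon> where "\<epsilon> = (u y - u x) / 2"
    have "\<epsilon> > 0" using u by (simp add: \<epsilon>_def)
    have cont: "continuous_on K u" using u(1) by (simp add: invariant_def)
    obtain a where a: "a \<in> J" "x \<in> box a" "\<And>z. z \<in> box a \<Longrightarrow> \<bar>u z - u x\<bar> < \<epsilon>"
      using box[OF x cont \<open>\<epsilon> > 0\<close>] by blast
    obtain b where b: "b \<in> J" "y \<in> box b" "\<And>z. z \<in> box b \<Longrightarrow> \<bar>u z - u y\<bar> < \<epsilon>"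
      using box[OF y cont \<open>\<epsilon> > 0\<close>] by blast
    have "u z < u x + \<epsilon>" if "z \<in> box a" for z
      using a(3)[OF that] by linarith
    moreover have "u x + \<epsilon> < u z" if "z \<in> box b" for z
    proof -
      have "u x + \<epsilon> = u y - \<epsilon>" by (simp add: \<epsilon>_def field_simps)
      then show ?thesis using b(3)[OF that] by linarith
    qed
    ultimately have "sepa (a, b) u" using u(1) by (auto simp: sepa_def)
    then obtain v where "sepa (a, b) v" "v \<in> G"
      using some[of "(a, b)" u] a(1) b(1) unfolding G_def by blast
    moreover from this(1) have "v x < v y"
      using a(2) b(2) by (auto simp: sepa_def intro: less_trans)
    ultimately show ?thesis using less_imp_neq by blast
  qed
  have "\<exists>v\<in>G. v x \<noteq> v y"
    if x: "x \<in> K" "truncate ?M x = x" and y: "y \<in> K" "truncate ?M y = y" and nE: "\<not> E x y" for x y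
  proof -
    obtain u where u: "invariant u" "u x \<noteq> u y"
      using separated[OF x(1) y(1) nE] unfolding invariant_def by blast
    then show ?thesis
      using strict[OF x y u(1)] strict[OF y x u(1)] by (metis linorder_neqE)
  qed
  then have "\<forall>x\<in>K. \<forall>y\<in>K. (\<forall>u\<in>G. u (truncate ?M x) = u (truncate ?M y)) \<longrightarrow>
      E (truncate ?M x) (truncate ?M y)"
    using cl_K[of _ X] by (metis Int_absorb truncate_truncate)
  with small inv show ?thesis
    unfolding adequate_def by blast
qed

text \<open>The closures of initial segments of \<open>X\<close> form a chain, and the new family
  consists of the increments of \<open>u\<close> along it. Equal increments propagate
  \<open>E\<close> up the chain by transfinite induction. Smallness holds because the layers added
  at distinct stages are disjoint, so a c0 point is large on only finitely many of them.\<close>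

lemma adequate_step:
  assumes wo: "Well_order r" and Field: "Field r = X" and ne: "X \<noteq> {}"
    and G0: "adequate {} G0" and G: "\<And>a. a \<in> X \<Longrightarrow> adequate (under r a) (G a)"
  shows "\<exists>H. adequate X H"
proof -
  have wo: "wo_rel r" by (simp add: wo_rel_def wo)
  note TOTAL = wo_rel.TOTAL[OF wo] and TRANS = wo_rel.TRANS[OF wo] and REFL = wo_rel.REFL[OF wo]
    and ANTISYM = wo_rel.ANTISYM[OF wo] and WF = wo_rel.WF[OF wo]
  have total: "a \<in> underS r b \<or> b \<in> underS r a" if "a \<in> X" "b \<in> X" "a \<noteq> b" for a b
    using TOTAL that Field by (auto simp: total_on_def underS_def)
  have under_underS: "under r b \<subseteq> underS r a" if "b \<in> underS r a" for a b
    using that TRANS ANTISYM by (auto simp: underS_def under_def elim: transE dest: antisymD)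
  have underS_X: "underS r a \<subseteq> X" for a
    using Field by (auto simp: underS_def intro: FieldI1)
  have in_under: "a \<in> under r a" if "a \<in> X" for a
    using that REFL Field by (auto simp: under_def refl_on_def)
  have under_X: "under r a \<subseteq> X" for a
    using Field by (auto simp: under_def intro: FieldI1)
  \<comment> \<open>\<open>P\<close> and \<open>Q\<close> truncate just after and just before stage
    \<open>a\<close>; using \<open>underS\<close> treats successor and limit stages alike.\<close>
  define P where "P = (\<lambda>a. truncate (cl (under r a)) :: ('i \<Rightarrow> real) \<Rightarrow> 'i \<Rightarrow> real)"
  define Q where "Q = (\<lambda>a. truncate (cl (underS r a)) :: ('i \<Rightarrow> real) \<Rightarrow> 'i \<Rightarrow> real)"
  \<comment> \<open>Every nonempty \<open>underS r a\<close> and the whole of \<open>X\<close> are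
    instances of \<open>S\<close>.\<close>
  have limit: "E (truncate (cl S) x) (truncate (cl S) y)"
    if S: "S \<noteq> {}" "S \<subseteq> X" "\<And>b. b \<in> S \<Longrightarrow> under r b \<subseteq> S" and xy: "x \<in> K" "y \<in> K"
      and E: "\<And>b. b \<in> S \<Longrightarrow> E (P b x) (P b y)" for S x y
  proof -
    let ?\<N> = "(\<lambda>b. cl (under r b)) ` S"
    have dir: "\<exists>C\<in>?\<N>. A \<union> B \<subseteq> C" if AB: "A \<in> ?\<N>" "B \<in> ?\<N>" for A B
    proof -
      obtain a b where ab: "a \<in> S" "A = cl (under r a)" "b \<in> S" "B = cl (under r b)"
        using AB by auto
      have "under r a \<subseteq> under r b \<or> under r b \<subseteq> under r a"
        using total[of a b] under_underS ab S(2) underS_subset_under[of r] by blast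
      then have "A \<union> B \<subseteq> B \<or> A \<union> B \<subseteq> A"
        unfolding ab using list_closure_mono by blast
      then show ?thesis using AB by blast
    qed
    have "list_closed T (\<Union>?\<N>)"
      by (rule list_closed_Union) (use S(1) dir list_closed_list_closure[of T] in auto)
    moreover have "S \<subseteq> \<Union>?\<N>"
    proof
      fix c assume "c \<in> S"
      then have "c \<in> cl (under r c)" using in_under S(2) subset_list_closure[of "under r c" T] by blast
      then show "c \<in> \<Union>?\<N>" using \<open>c \<in> S\<close> by blast
    qed
    ultimately have "cl S \<subseteq> \<Union>?\<N>" by (intro list_closure_least)
    moreover have "\<Union>?\<N> \<subseteq> cl S"
      using S(3) by (intro UN_least list_closure_mono)
    ultimately have eq: "\<Union>?\<N> = cl S" by blast
    have "E (truncate (\<Union>?\<N>) x) (truncate (\<Union>?\<N>) y)"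
      by (rule E_truncate_Union) (use S(1) dir xy E list_closed_list_closure[of T] in \<open>auto simp: P_def\<close>)
    then show ?thesis unfolding eq .
  qed
  define h where "h = (\<lambda>a u x. u (P a x) - (u (Q a x) :: real))"
  \<comment> \<open>The starting stage of the chain: \<open>cl {}\<close> contains
    \<open>T []\<close> and so may be nonempty.\<close>
  define h0 :: "(('i \<Rightarrow> real) \<Rightarrow> real) \<Rightarrow> ('i \<Rightarrow> real) \<Rightarrow> real"
    where "h0 = (\<lambda>u x. u (truncate (cl {}) x))"
  define H where "H = h0 ` G0 \<union> (\<Union>a\<in>X. h a ` G a)"
  have inv: "invariant u" if "u \<in> H" for u
    using that G0 G invariant_comp_truncate
    by (auto simp: H_def h_def h0_def P_def Q_def adequate_def intro!: invariant_diff)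
  have sep: "E (truncate (cl X) x) (truncate (cl X) y)"
    if xy: "x \<in> K" "y \<in> K" and H: "\<And>u. u \<in> H \<Longrightarrow> u (truncate (cl X) x) = u (truncate (cl X) y)" for x y
  proof -
    have P: "P a (truncate (cl X) z) = P a z" and Q: "Q a (truncate (cl X) z) = Q a z" for a z
      using list_closure_mono[OF under_X[of a], of T] list_closure_mono[OF underS_X[of a], of T]
      by (simp_all add: P_def Q_def Int_absorb2)
    have h: "u (P a x) - u (Q a x) = u (P a y) - u (Q a y)" if "a \<in> X" "u \<in> G a" for a u
      using H[of "h a u"] that by (auto simp: H_def h_def P Q)
    \<comment> \<open>Equal increments turn agreement before stage \<open>a\<close> into agreement
      after it; adequacy of \<open>G a\<close> then gives \<open>E\<close>.\<close>
    have QP: "E (P a x) (P a y)" if "a \<in> X" "E (Q a x) (Q a y)" for a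
    proof -
      have "u (P a x) = u (P a y)" if u: "u \<in> G a" for u
      proof -
        have "invariant u" using u G \<open>a \<in> X\<close> by (auto simp: adequate_def)
        then have "u (Q a x) = u (Q a y)"
          using \<open>E (Q a x) (Q a y)\<close> xy cl_K by (auto simp: invariant_def Q_def)
        then show ?thesis using h[OF \<open>a \<in> X\<close> u] by simp
      qed
      then show ?thesis using G[OF that(1)] xy by (auto simp: adequate_def P_def)
    qed
    have "E (Q a x) (Q a y)" if "a \<in> X" for a
      using that
    proof (induction a rule: wf_induct_rule[OF WF])
      case (1 a)
      show ?case
      proof (cases "underS r a = {}")
        case True
        have "E (truncate (cl {}) x) (truncate (cl {}) y)"
        proof -
          have "u (truncate (cl {}) x) = u (truncate (cl {}) y)" if "u \<in> G0" for u
            using H[of "h0 u"] that list_closure_mono[of "{}" X T] by (auto simp: H_def h0_def Int_absorb2)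
          then show ?thesis using G0 xy by (auto simp: adequate_def)
        qed
        then show ?thesis using True by (simp add: Q_def)
      next
        case False
        have "E (P b x) (P b y)" if "b \<in> underS r a" for b
          using QP[of b] 1(1)[of b] that underS_X by (auto simp: underS_def)
        then show ?thesis
          unfolding Q_def using False underS_X under_underS xy by (intro limit)
      qed
    qed
    then have "E (P a x) (P a y)" if "a \<in> X" for a using QP that by blast
    then show ?thesis using ne under_X xy by (intro limit subset_refl)
  qed
  have "sigma_small H"
    unfolding sigma_small_def
  proof (intro allI impI)
    fix \<epsilon> :: real assume "\<epsilon> > 0"
    have "sigma_small G0" using G0 by (simp add: adequate_def)
    then obtain C0 :: "nat \<Rightarrow> (('i \<Rightarrow> real) \<Rightarrow> real) set" where C0: "G0 \<subseteq> (\<Union>n. C0 n)"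
      "\<forall>n. \<forall>d\<in>c0_points. finite {u \<in> C0 n. \<bar>u d\<bar> > \<epsilon>}"
      using \<open>\<epsilon> > 0\<close> by (rule sigma_smallE)
    \<comment> \<open>The bound \<epsilon>/2 is used because a difference exceeding \<epsilon> has a
      term exceeding \<epsilon>/2.\<close>
    have "\<forall>a\<in>X. \<exists>C :: nat \<Rightarrow> (('i \<Rightarrow> real) \<Rightarrow> real) set. G a \<subseteq> (\<Union>n. C n) \<and>
        (\<forall>n. \<forall>d\<in>c0_points. finite {u \<in> C n. \<bar>u d\<bar> > \<epsilon>/2})"
    proof
      fix a assume "a \<in> X"
      then have "sigma_small (G a)" using G by (simp add: adequate_def)
      moreover have "\<epsilon>/2 > 0" using \<open>\<epsilon> > 0\<close> by simp
      ultimately show "\<exists>C :: nat \<Rightarrow> (('i \<Rightarrow> real) \<Rightarrow> real) set. G a \<subseteq> (\<Union>n. C n) \<and>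
          (\<forall>n. \<forall>d\<in>c0_points. finite {u \<in> C n. \<bar>u d\<bar> > \<epsilon>/2})"
        unfolding sigma_small_def by presburger
    qed
    from bchoice[OF this] obtain C :: "'i \<Rightarrow> nat \<Rightarrow> (('i \<Rightarrow> real) \<Rightarrow> real) set" where
      C': "\<forall>a\<in>X. G a \<subseteq> (\<Union>n. C a n) \<and> (\<forall>n. \<forall>d\<in>c0_points. finite {u \<in> C a n. \<bar>u d\<bar> > \<epsilon>/2})"
      by (elim exE)
    have C: "\<And>a. a \<in> X \<Longrightarrow> G a \<subseteq> (\<Union>n. C a n)"
      "\<And>a n d. a \<in> X \<Longrightarrow> d \<in> c0_points \<Longrightarrow> finite {u \<in> C a n. \<bar>u d\<bar> > \<epsilon>/2}"
      using C' by simp_all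
    \<comment> \<open>Closeness in all coordinates at once suffices here, since \<open>P a d\<close>
      and \<open>Q a d\<close> differ only by the values of \<open>d\<close> on one layer. The
      classes are split by \<open>k\<close> so that a single size of coordinate matters for all
      members of a class.\<close>
    define modulus where "modulus = (\<lambda>k u. \<forall>x\<in>K. \<forall>y\<in>K. (\<forall>i. \<bar>x i - y i\<bar> < 1 / Suc k) \<longrightarrow> \<bar>u x - (u y :: real)\<bar> < \<epsilon>)"
    define B where "B = (\<lambda>n k. h0 ` C0 n \<union> (\<Union>a\<in>X. h a ` {u \<in> C a n. modulus k u}))"
    have modulus: "\<exists>k. modulus k u" if "invariant u" for u
    proof -
      have "continuous_on K u" using that by (simp add: invariant_def)
      from compact_uniformly_continuous_fun[OF compact this \<open>\<epsilon> > 0\<close>] obtain F \<delta> where F: "\<delta> > 0"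
        "\<And>x y. x \<in> K \<Longrightarrow> y \<in> K \<Longrightarrow> \<forall>i\<in>F. \<bar>x i - y i\<bar> < \<delta> \<Longrightarrow> \<bar>u x - u y\<bar> < \<epsilon>"
        by metis
      obtain k where "1 / Suc k < \<delta>"
        using F(1) by (metis inverse_eq_divide reals_Archimedean)
      then have "modulus k u"
        unfolding modulus_def using F(2) by (meson less_trans)
      then show ?thesis ..
    qed
    have "H \<subseteq> (\<Union>p. case_prod B (prod_decode p))"
    proof
      fix v assume "v \<in> H"
      then consider u where "u \<in> G0" "v = h0 u" | a u where "a \<in> X" "u \<in> G a" "v = h a u"
        by (auto simp: H_def)
      then have "\<exists>n k. v \<in> B n k"
      proof cases
        case 1
        then obtain n where "u \<in> C0 n" using C0(1) by auto
        \<comment> \<open>The images under \<open>h0\<close> belong to \<open>B n k\<close> for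
          every \<open>k\<close>; 0 is an arbitrary choice.\<close>
        then have "v \<in> B n 0" using 1(2) unfolding B_def by simp
        then show ?thesis by iprover
      next
        case 2
        then have "invariant u" using G by (simp add: adequate_def)
        then obtain k where k: "modulus k u" using modulus by metis
        obtain n where n: "u \<in> C a n" using 2(2) C(1)[OF 2(1)] by auto
        have "v \<in> h a ` {u \<in> C a n. modulus k u}" using n k 2(3) by simp
        then have "v \<in> B n k" using 2(1) unfolding B_def by (intro UnI2 UN_I)
        then show ?thesis by iprover
      qed
      then obtain n k where "v \<in> B n k" by (elim exE)
      then show "v \<in> (\<Union>p. case_prod B (prod_decode p))"
        by (intro UN_I[of "prod_encode (n, k)"]) auto
    qed
    moreover have "finite {v \<in> B n k. \<bar>v d\<bar> > \<epsilon>}" if d: "d \<in> c0_points" for n k d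
    proof -
      have dK: "d \<in> K" using d by (simp add: c0_points_def)
      \<comment> \<open>The stages at which \<open>d\<close> is not small on the new layer. Since
        the layers are disjoint, choosing a witness coordinate for each stage is injective, and
        \<open>d\<close> being c0 makes \<open>A\<close> finite.\<close>
      define A where "A = {a \<in> X. \<exists>i\<in>cl (under r a) - cl (underS r a). \<bar>d i\<bar> \<ge> 1 / Suc k}"
      have "\<exists>i. a \<in> A \<longrightarrow> i \<in> cl (under r a) - cl (underS r a) \<and> \<bar>d i\<bar> \<ge> 1 / Suc k" for a
        by (auto simp: A_def)
      then obtain \<iota> where \<iota>: "\<And>a. a \<in> A \<Longrightarrow> \<iota> a \<in> cl (under r a) - cl (underS r a)"
        "\<And>a. a \<in> A \<Longrightarrow> \<bar>d (\<iota> a)\<bar> \<ge> 1 / Suc k" by metis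
      have "inj_on \<iota> A"
      proof (rule inj_onI, rule ccontr)
        fix a b assume ab: "a \<in> A" "b \<in> A" "\<iota> a = \<iota> b" "a \<noteq> b"
        then have "a \<in> X" "b \<in> X" by (auto simp: A_def)
        then consider "a \<in> underS r b" | "b \<in> underS r a" using total ab(4) by blast
        then show False
        proof cases
          case 1
          then show ?thesis
            using list_closure_mono[OF under_underS[OF 1], of T] \<iota>(1)[OF ab(1)] \<iota>(1)[OF ab(2)] ab(3) by auto
        next
          case 2
          then show ?thesis
            using list_closure_mono[OF under_underS[OF 2], of T] \<iota>(1)[OF ab(1)] \<iota>(1)[OF ab(2)] ab(3) by auto
        qed
      qed
      moreover have "finite (\<iota> ` A)"
      proof (rule finite_subset)
        \<comment> \<open>\<open>A\<close> uses a weak inequality and \<open>c0_points\<close> a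
          strict one; passing to the next reciprocal closes the gap.\<close>
        show "\<iota> ` A \<subseteq> {i. \<bar>d i\<bar> > 1 / Suc (Suc k)}"
        proof clarify
          fix a assume "a \<in> A"
          have "1 / real (Suc (Suc k)) < 1 / real (Suc k)" by (simp add: field_simps)
          then show "\<bar>d (\<iota> a)\<bar> > 1 / Suc (Suc k)" using \<iota>(2)[OF \<open>a \<in> A\<close>] by linarith
        qed
        show "finite {i. \<bar>d i\<bar> > 1 / Suc (Suc k)}"
          using d by (simp add: c0_points_def)
      qed
      ultimately have "finite A" using finite_imageD by blast
      \<comment> \<open>\<open>P a d\<close> and \<open>Q a d\<close> are again c0 points, so for
        each \<open>a\<close> in \<open>A\<close> only finitely many members of the class are large
        at one of them.\<close>
      define R where "R = (\<lambda>a. {u \<in> C a n. \<bar>u (P a d)\<bar> > \<epsilon>/2} \<union> {u \<in> C a n. \<bar>u (Q a d)\<bar> > \<epsilon>/2})"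
      have "finite (R a)" if "a \<in> A" for a
        using that C(2) cl_c0[OF d] by (auto simp: A_def R_def P_def Q_def)
      then have fin: "finite (h0 ` {u \<in> C0 n. \<bar>u (truncate (cl {}) d)\<bar> > \<epsilon>} \<union> (\<Union>a\<in>A. h a ` R a))"
        using \<open>finite A\<close> C0(2) cl_c0[OF d] by auto
      \<comment> \<open>Outside \<open>A\<close> the modulus keeps the increment below \<epsilon>; a
        large increment also needs a large term.\<close>
      have "a \<in> A \<and> u \<in> R a" if a: "a \<in> X" "u \<in> C a n" "modulus k u" "\<bar>h a u d\<bar> > \<epsilon>" for a u
      proof
        show "a \<in> A"
        proof (rule ccontr)
          assume "a \<notin> A"
          have "cl (underS r a) \<subseteq> cl (under r a)"
            using underS_subset_under by (rule list_closure_mono)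
          then have "\<bar>P a d i - Q a d i\<bar> < 1 / Suc k" for i
            using \<open>a \<notin> A\<close> a(1) by (auto simp: A_def P_def Q_def truncate_def not_le)
          then have "\<bar>u (P a d) - u (Q a d)\<bar> < \<epsilon>"
            using a(3) cl_K[OF dK] by (simp add: modulus_def P_def Q_def)
          then show False using a(4) by (simp add: h_def)
        qed
        have "\<bar>u (P a d)\<bar> > \<epsilon>/2 \<or> \<bar>u (Q a d)\<bar> > \<epsilon>/2"
          using a(4) unfolding h_def by argo
        then show "u \<in> R a" using a(2) by (auto simp: R_def)
      qed
      then have "{v \<in> B n k. \<bar>v d\<bar> > \<epsilon>} \<subseteq>
          h0 ` {u \<in> C0 n. \<bar>u (truncate (cl {}) d)\<bar> > \<epsilon>} \<union> (\<Union>a\<in>A. h a ` R a)"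
        by (fastforce simp: B_def h0_def)
      then show ?thesis using fin by (rule finite_subset)
    qed
    ultimately show "\<exists>C :: nat \<Rightarrow> _ set. H \<subseteq> (\<Union>n. C n) \<and> (\<forall>n. \<forall>d\<in>c0_points. finite {u \<in> C n. \<bar>u d\<bar> > \<epsilon>})"
      by (intro exI[of _ "\<lambda>p. case_prod B (prod_decode p)"]) (auto split: prod.splits)
  qed
  then have "adequate X H"
    unfolding adequate_def using inv sep by simp
  then show ?thesis ..
qed

text \<open>In the well-order \<open>card_of X\<close> proper initial segments have smaller
  cardinality than \<open>X\<close>, so the induction hypothesis supplies the families that
  \<open>adequate_step\<close> requires.\<close>

theorem ex_adequate: "\<exists>G. adequate X G"
proof (induction X rule: wf_induct_rule[OF wf_inv_image[OF wf_ordLess, of card_of]])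
  case (1 X)
  show ?case
  proof (cases "countable X")
    case True
    then show ?thesis by (rule adequate_countable)
  next
    case False
    then have inf: "infinite X" using countable_finite by blast
    let ?r = "card_of X"
    have co: "Card_order ?r" by (rule card_of_Card_order)
    have Field: "Field ?r = X" by (rule Field_card_of)
    have "\<exists>G. adequate (under ?r a) G" if "a \<in> X" for a
    proof (rule 1)
      \<comment> \<open>An infinite cardinal order has no last element. Hence the closed segment of
        \<open>a\<close> fits into the open segment of some larger \<open>b\<close>, whose
        cardinality is smaller than that of \<open>X\<close>.\<close>
      have "under ?r a \<noteq> X"
        using Card_order_infinite_not_under[OF co] inf unfolding Field by metis
      moreover have "under ?r a \<subseteq> X"
        using under_Field[of ?r a] unfolding Field .
      ultimately obtain b where b: "b \<in> X" "(b, a) \<notin> ?r"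
        unfolding under_def by auto
      have wo: "wo_rel ?r" by (simp add: wo_rel_def card_of_Well_order)
      have ab: "(a, b) \<in> ?r"
        using wo_rel.TOTALS[OF wo] b that Field by blast
      have "under ?r a \<subseteq> underS ?r b"
      proof
        fix c assume "c \<in> under ?r a"
        then have ca: "(c, a) \<in> ?r" by (simp add: under_def)
        then have "(c, b) \<in> ?r" using transD[OF wo_rel.TRANS[OF wo] ca ab] by simp
        moreover have "c \<noteq> b" using ca b(2) by auto
        ultimately show "c \<in> underS ?r b" by (simp add: underS_def)
      qed
      then have "(card_of (under ?r a), card_of (underS ?r b)) \<in> ordLeq" by (rule card_of_mono1)
      moreover have "(card_of (underS ?r b), ?r) \<in> ordLess"
        using card_of_underS[OF co] b(1) Field by blast
      ultimately have "(card_of (under ?r a), ?r) \<in> ordLess" by (rule ordLeq_ordLess_trans)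
      then show "(under ?r a, X) \<in> inv_image ordLess card_of"
        by (simp add: in_inv_image)
    qed
    then have "\<forall>a\<in>X. \<exists>G. adequate (under ?r a) G" by (intro ballI)
    from bchoice[OF this] obtain G where G: "\<forall>a\<in>X. adequate (under ?r a) (G a)"
      by (elim exE)
    obtain G0 where G0: "adequate {} G0" using adequate_countable[of "{}"] by auto
    have ne: "X \<noteq> {}" using inf by auto
    show ?thesis
      by (rule adequate_step[OF card_of_Well_order Field ne G0]) (rule bspec[OF G])
  qed
qed

end

subsection \<open>Embeddings from separating families\<close>

text \<open>Continuous and zero on \<open>[-e, e]\<close>: a family with finitely many members
  exceeding \<open>e\<close> at a point becomes one with finitely many nonzero values there.\<close>

definition soft_threshold :: "real \<Rightarrow> real \<Rightarrow> real" where
  "soft_threshold e t = t - max (- e) (min e t)"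

lemma soft_threshold_eq_0: "\<bar>t\<bar> \<le> e \<Longrightarrow> soft_threshold e t = 0"
  by (auto simp: soft_threshold_def max_def min_def)

text \<open>If \<open>e\<close> is below the modulus of each nonzero one of \<open>s\<close> and
  \<open>t\<close>, then signs are kept and nonzero values move towards 0 by the same amount
  \<open>e\<close>.\<close>

lemma soft_threshold_separates:
  assumes "s \<noteq> t"
  obtains m :: nat where "soft_threshold (1 / Suc m) s \<noteq> soft_threshold (1 / Suc m) t"
proof -
  \<comment> \<open>A value 0 imposes no condition on the threshold, hence the default 1.\<close>
  define \<mu> where "\<mu> = min (if s = 0 then 1 else \<bar>s\<bar>) (if t = 0 then 1 else \<bar>t\<bar>)"
  have "\<mu> > 0" by (auto simp: \<mu>_def)
  then obtain m where m: "1 / Suc m < \<mu>"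
    by (metis inverse_eq_divide reals_Archimedean)
  define e where "e = 1 / real (Suc m)"
  have "e > 0" by (simp add: e_def)
  have e: "e < \<mu>" using m by (simp add: e_def)
  then have "s = 0 \<or> e < \<bar>s\<bar>" "t = 0 \<or> e < \<bar>t\<bar>"
    by (auto simp: \<mu>_def split: if_splits)
  then have "soft_threshold e s \<noteq> soft_threshold e t"
    using assms \<open>e > 0\<close> unfolding soft_threshold_def max_def min_def by (auto split: if_splits)
  then show thesis using that by (simp add: e_def)
qed

text \<open>The classes for the bound \<open>1 / Suc m\<close> are thresholded at that bound, so
  each contributes finitely many nonzero coordinates at a point of \<open>D\<close>. The bounded
  \<open>arctan\<close> divided by \<open>Suc (m + n)\<close> then leaves only finitely many classes
  above any given \<epsilon>. Using all \<open>m\<close> preserves separation.\<close>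

lemma semi_Eberlein_functions:
  fixes H :: "('b \<Rightarrow> real) set"
  assumes L: "compact_space L" and dense: "dense_in L D"
    and cont: "\<And>v. v \<in> H \<Longrightarrow> continuous_map L euclideanreal v"
    and sep: "\<And>x y. x \<in> topspace L \<Longrightarrow> y \<in> topspace L \<Longrightarrow> \<forall>v\<in>H. v x = v y \<Longrightarrow> x = y"
    and small: "\<And>\<epsilon>. \<epsilon> > 0 \<Longrightarrow> \<exists>C :: nat \<Rightarrow> ('b \<Rightarrow> real) set. H \<subseteq> (\<Union>n. C n) \<and>
      (\<forall>n. \<forall>d\<in>D. finite {v \<in> C n. \<bar>v d\<bar> > \<epsilon>})"
  shows "semi_Eberlein L"
proof -
  have "\<forall>m. \<exists>C :: nat \<Rightarrow> ('b \<Rightarrow> real) set. H \<subseteq> (\<Union>n. C n) \<and>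
      (\<forall>n. \<forall>d\<in>D. finite {v \<in> C n. \<bar>v d\<bar> > 1 / Suc m})"
    by (intro allI small) simp
  from choice[OF this] obtain C :: "nat \<Rightarrow> nat \<Rightarrow> ('b \<Rightarrow> real) set" where
    C: "\<forall>m. H \<subseteq> (\<Union>n. C m n) \<and> (\<forall>n. \<forall>d\<in>D. finite {v \<in> C m n. \<bar>v d\<bar> > 1 / Suc m})"
    by (elim exE)
  define J where "J = {(v, m, n). v \<in> H \<and> v \<in> C m n}"
  define w :: "('b \<Rightarrow> real) \<times> nat \<times> nat \<Rightarrow> 'b \<Rightarrow> real" where
    "w = (\<lambda>(v, m, n) y. arctan (soft_threshold (1 / Suc m) (v y)) / Suc (m + n))"
  define g where "g = (\<lambda>y. restrict (\<lambda>j. w j y) J)"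
  have "continuous_map L euclideanreal (w j)" if j: "j \<in> J" for j
  proof -
    obtain v m n where "j = (v, m, n)" "v \<in> H" using j by (auto simp: J_def)
    have "continuous_on UNIV (\<lambda>t. arctan (soft_threshold (1 / Suc m) t) / Suc (m + n))"
      unfolding soft_threshold_def by (intro continuous_intros) simp_all
    then have "continuous_map euclideanreal euclideanreal (\<lambda>t. arctan (soft_threshold (1 / Suc m) t) / Suc (m + n))"
      by simp
    from continuous_map_compose[OF cont[OF \<open>v \<in> H\<close>] this] show ?thesis
      by (simp add: \<open>j = (v, m, n)\<close> w_def o_def)
  qed
  then have "continuous_map L (powertop_real J) g"
    by (auto simp: continuous_map_componentwise g_def)
  moreover have "inj_on g (topspace L)"
  proof (rule inj_onI)
    fix x y assume xy: "x \<in> topspace L" "y \<in> topspace L" and eq: "g x = g y"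
    have "v x = v y" if v: "v \<in> H" for v
    proof (rule ccontr)
      assume "v x \<noteq> v y"
      then obtain m where m: "soft_threshold (1 / Suc m) (v x) \<noteq> soft_threshold (1 / Suc m) (v y)"
        by (rule soft_threshold_separates)
      obtain n where "v \<in> C m n" using C v by blast
      then have "(v, m, n) \<in> J" using v by (simp add: J_def)
      then have "w (v, m, n) x = w (v, m, n) y"
        using fun_cong[OF eq, of "(v, m, n)"] by (simp add: g_def)
      then show False using m by (simp add: w_def arctan_eq_iff)
    qed
    then show "x = y" using sep xy by blast
  qed
  ultimately have "embedding_map L (powertop_real J) g"
    using L by (intro continuous_imp_embedding_map) (auto simp: Hausdorff_space_product_topology)
  moreover have "g d \<in> c0_set J" if d: "d \<in> D" for d
  proof -
    have "finite {j \<in> J. \<bar>g d j\<bar> > \<epsilon>}" if "\<epsilon> > 0" for \<epsilon>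
    proof -
      \<comment> \<open>As \<open>arctan\<close> is bounded by 2, a coordinate above \<epsilon>
        forces \<open>m + n < N\<close>.\<close>
      obtain N where N: "2 / \<epsilon> < real N" using reals_Archimedean2 by blast
      let ?S = "\<Union>m\<in>{..N}. \<Union>n\<in>{..N}. (\<lambda>v. (v, m, n)) ` {v \<in> C m n. \<bar>v d\<bar> > 1 / Suc m}"
      have "finite ?S" using C d by simp
      moreover have "{j \<in> J. \<bar>g d j\<bar> > \<epsilon>} \<subseteq> ?S"
      proof clarify
        fix v m n assume j: "(v, m, n) \<in> J" "\<bar>g d (v, m, n)\<bar> > \<epsilon>"
        let ?a = "arctan (soft_threshold (1 / Suc m) (v d))"
        have a: "\<bar>?a\<bar> / Suc (m + n) > \<epsilon>" using j by (simp add: g_def w_def)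
        have "\<bar>?a\<bar> < 2"
          using arctan_bounded[of "soft_threshold (1 / Suc m) (v d)"] pi_less_4 by linarith
        then have "\<epsilon> * Suc (m + n) < 2"
          using a by (simp add: field_simps)
        then have "real (Suc (m + n)) < 2 / \<epsilon>"
          using \<open>\<epsilon> > 0\<close> by (simp add: field_simps)
        then have "m + n < N" using N by linarith
        moreover have "\<bar>v d\<bar> > 1 / Suc m"
        proof (rule ccontr)
          assume "\<not> ?thesis"
          then have "?a = 0" by (simp add: soft_threshold_eq_0)
          then show False using a \<open>\<epsilon> > 0\<close> by simp
        qed
        moreover have "v \<in> C m n" using j(1) by (simp add: J_def)
        ultimately show "(v, m, n) \<in> ?S"
          by (intro UN_I[of m] UN_I[of n]) auto
      qed
      ultimately show ?thesis by (rule finite_subset[rotated])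
    qed
    then show ?thesis by (simp add: c0_set_def g_def)
  qed
  then have "D \<subseteq> {x \<in> topspace L. g x \<in> c0_set J}"
    using dense by (auto simp: dense_in_def)
  then have "dense_in L {x \<in> topspace L. g x \<in> c0_set J}"
    using dense closure_of_mono[of D _ L] closure_of_subset_topspace[of L]
    unfolding dense_in_def by blast
  ultimately show ?thesis using L by (intro semi_EberleinI)
qed

subsection \<open>Continuous images\<close>

lemma c0_set_subset_Sigma_set: "c0_set I \<subseteq> Sigma_set I"
proof
  fix x assume x: "x \<in> c0_set I"
  have "{i \<in> I. x i \<noteq> 0} \<subseteq> (\<Union>n. {i \<in> I. \<bar>x i\<bar> > 1 / Suc n})"
  proof clarify
    fix i assume "i \<in> I" "x i \<noteq> 0"
    then obtain n where "1 / Suc n < \<bar>x i\<bar>"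
      by (metis inverse_eq_divide reals_Archimedean zero_less_abs_iff)
    then show "i \<in> (\<Union>n. {i \<in> I. \<bar>x i\<bar> > 1 / Suc n})" using \<open>i \<in> I\<close> by blast
  qed
  moreover have "finite {i \<in> I. \<bar>x i\<bar> > 1 / real (Suc n)}" for n
    using x by (simp add: c0_set_def)
  then have "countable (\<Union>n. {i \<in> I. \<bar>x i\<bar> > 1 / real (Suc n)})"
    by (intro countable_UN) (auto intro: countable_finite)
  ultimately have "countable {i \<in> I. x i \<noteq> 0}" by (rule countable_subset)
  then show "x \<in> Sigma_set I" using x by (simp add: c0_set_def Sigma_set_def)
qed

text \<open>\<open>truncate_closed_operator\<close> is applied to the graph of \<open>E\<close>,
  each pair being coded as one function into the plane so that truncation acts on both points at
  once. The graph is closed because invariant functions separate unrelated points; its diagonal,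
  present by reflexivity, gives invariance of \<open>K\<close>.\<close>

lemma ex_retractive_compact:
  fixes K :: "('i \<Rightarrow> real) set"
  assumes compact: "compact K" and refl: "\<And>x. x \<in> K \<Longrightarrow> E x x"
    and separated: "\<And>x y. x \<in> K \<Longrightarrow> y \<in> K \<Longrightarrow> \<not> E x y \<Longrightarrow>
      \<exists>u. continuous_on K u \<and> (\<forall>a\<in>K. \<forall>b\<in>K. E a b \<longrightarrow> u a = u b) \<and> u x \<noteq> (u y :: real)"
    and dense: "\<And>x y F \<delta>. x \<in> K \<Longrightarrow> y \<in> K \<Longrightarrow> E x y \<Longrightarrow> finite F \<Longrightarrow> \<delta> > 0 \<Longrightarrow>
      \<exists>a\<in>K. \<exists>b\<in>K. E a b \<and> countable {i. a i \<noteq> 0} \<and> countable {i. b i \<noteq> 0} \<and>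
        (\<forall>i\<in>F. \<bar>a i - x i\<bar> < \<delta> \<and> \<bar>b i - y i\<bar> < \<delta>)"
  shows "\<exists>T. retractive_compact K E T"
proof -
  define pair :: "('i \<Rightarrow> real) \<Rightarrow> ('i \<Rightarrow> real) \<Rightarrow> 'i \<Rightarrow> real \<times> real" where
    "pair = (\<lambda>x y i. (x i, y i))"
  define X where "X = {pair x y | x y. x \<in> K \<and> y \<in> K \<and> E x y}"
  define D where "D = {pair x y | x y. x \<in> K \<and> y \<in> K \<and> E x y \<and> countable {i. x i \<noteq> 0} \<and> countable {i. y i \<noteq> 0}}"
  have pair_iff: "pair x y \<in> X \<longleftrightarrow> x \<in> K \<and> y \<in> K \<and> E x y" for x y
  proof -
    have "x = x' \<and> y = y'" if "pair x y = pair x' y'" for x' y'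
      using that unfolding pair_def fun_eq_iff by simp
    then show ?thesis unfolding X_def by blast
  qed
  have pair_truncate: "truncate M (pair x y) = pair (truncate M x) (truncate M y)" for M x y
    by (auto simp: pair_def truncate_def zero_prod_def)
  have "closed K" using compact by (rule compact_imp_closed_fun)
  have "closure X \<subseteq> X"
  proof
    fix z assume z: "z \<in> closure X"
    define x where "x = fst \<circ> z"
    define y where "y = snd \<circ> z"
    have "z = pair x y" by (simp add: pair_def x_def y_def)
    have near: "\<exists>a\<in>K. \<exists>b\<in>K. E a b \<and> (\<forall>i\<in>F. \<bar>a i - x i\<bar> < \<delta> \<and> \<bar>b i - y i\<bar> < \<delta>)"
      if F: "finite F" "\<delta> > 0" for F \<delta>
    proof -
      obtain c where c: "c \<in> X" "\<And>i. i \<in> F \<Longrightarrow> dist (c i) (z i) < \<delta>"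
        using closure_fun_approachable[of z X] z F by blast
      then obtain a b where ab: "c = pair a b" "a \<in> K" "b \<in> K" "E a b" by (auto simp: X_def)
      have "\<bar>a i - x i\<bar> < \<delta> \<and> \<bar>b i - y i\<bar> < \<delta>" if "i \<in> F" for i
        using c(2)[OF that] dist_fst_le[of "c i" "z i"] dist_snd_le[of "c i" "z i"]
        unfolding ab(1) \<open>z = pair x y\<close> by (simp add: pair_def dist_real_def)
      then show ?thesis using ab by blast
    qed
    have "x \<in> closure K" "y \<in> closure K"
      unfolding closure_fun_approachable dist_real_def using near by blast+
    then have xy: "x \<in> K" "y \<in> K" using \<open>closed K\<close> by simp_all
    have "E x y"
    proof (rule ccontr)
      assume "\<not> E x y"
      then obtain u where u: "continuous_on K u" "\<forall>a\<in>K. \<forall>b\<in>K. E a b \<longrightarrow> u a = u b"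
        "u x \<noteq> (u y :: real)"
        using separated[OF xy] by blast
      define \<epsilon> where "\<epsilon> = \<bar>u x - u y\<bar> / 2"
      have "\<epsilon> > 0" using u(3) by (simp add: \<epsilon>_def)
      obtain F \<delta> where F: "finite F" "\<delta> > 0"
        "\<And>x y. x \<in> K \<Longrightarrow> y \<in> K \<Longrightarrow> \<forall>i\<in>F. \<bar>x i - y i\<bar> < \<delta> \<Longrightarrow> \<bar>u x - u y\<bar> < \<epsilon>"
        using compact_uniformly_continuous_fun[OF compact u(1) \<open>\<epsilon> > 0\<close>] by blast
      obtain a b where ab: "a \<in> K" "b \<in> K" "E a b" "\<forall>i\<in>F. \<bar>a i - x i\<bar> < \<delta> \<and> \<bar>b i - y i\<bar> < \<delta>"
        using near[OF F(1,2)] by blast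
      have "\<bar>u a - u x\<bar> < \<epsilon>" "\<bar>u b - u y\<bar> < \<epsilon>"
        using F(3) ab xy by blast+
      moreover have "u a = u b" using u(2) ab by blast
      then have "\<bar>u x - u y\<bar> \<le> \<bar>u a - u x\<bar> + \<bar>u b - u y\<bar>" by linarith
      ultimately show False by (simp add: \<epsilon>_def)
    qed
    then show "z \<in> X" using xy \<open>z = pair x y\<close> pair_iff by blast
  qed
  then have "closed X" using closure_subset_eq by blast
  moreover have "D \<subseteq> X" by (auto simp: D_def X_def)
  moreover have "X \<subseteq> closure D"
  proof
    fix z assume "z \<in> X"
    then obtain x y where xy: "z = pair x y" "x \<in> K" "y \<in> K" "E x y" by (auto simp: X_def)
    show "z \<in> closure D"
      unfolding closure_fun_approachable
    proof (intro allI impI, elim conjE)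
      fix F :: "'i set" and \<delta> :: real assume F: "finite F" "\<delta> > 0"
      then have "\<delta>/2 > 0" by simp
      from dense[OF xy(2-4) F(1) this] obtain a b where
        ab: "a \<in> K" "b \<in> K" "E a b" "countable {i. a i \<noteq> 0}" "countable {i. b i \<noteq> 0}"
          "\<forall>i\<in>F. \<bar>a i - x i\<bar> < \<delta>/2 \<and> \<bar>b i - y i\<bar> < \<delta>/2"
        by blast
      have "dist (pair a b i) (z i) < \<delta>" if "i \<in> F" for i
      proof -
        have "dist (pair a b i) (z i) \<le> \<bar>a i - x i\<bar> + \<bar>b i - y i\<bar>"
          unfolding xy(1) pair_def dist_prod_def by (simp add: dist_real_def sqrt_sum_squares_le_sum_abs)
        moreover have "\<bar>a i - x i\<bar> < \<delta>/2" "\<bar>b i - y i\<bar> < \<delta>/2" using ab(6) that by auto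
        ultimately show ?thesis by linarith
      qed
      moreover have "pair a b \<in> D" using ab(1-5) by (auto simp: D_def)
      ultimately show "\<exists>c\<in>D. \<forall>i\<in>F. dist (c i) (z i) < \<delta>" by blast
    qed
  qed
  moreover have "countable {i. d i \<noteq> 0}" if dD: "d \<in> D" for d
  proof -
    obtain a b where ab: "d = pair a b" "countable {i. a i \<noteq> 0}" "countable {i. b i \<noteq> 0}"
      using dD by (auto simp: D_def)
    have "{i. d i \<noteq> 0} \<subseteq> {i. a i \<noteq> 0} \<union> {i. b i \<noteq> 0}"
      by (auto simp: ab(1) pair_def zero_prod_def)
    then show ?thesis using ab(2,3) by (meson countable_Un countable_subset)
  qed
  ultimately obtain T :: "'i list \<Rightarrow> 'i set" where T: "\<forall>l. countable (T l)"
    "\<forall>M. list_closed T M \<longrightarrow> (\<forall>z\<in>X. truncate M z \<in> X)"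
    by (rule truncate_closed_operator)
  have "truncate M x \<in> K \<and> truncate M y \<in> K \<and> E (truncate M x) (truncate M y)"
    if "list_closed T M" "x \<in> K" "y \<in> K" "E x y" for M x y
    using bspec[OF mp[OF spec[OF T(2)] that(1)], of "pair x y"] that pair_iff by (simp add: pair_truncate)
  then have "retractive_compact K E T"
    using compact separated T(1) refl by unfold_locales blast+
  then show ?thesis by blast
qed

text \<open>Turns the extensional functions of \<open>powertop_real I\<close> into total functions
  vanishing off \<open>I\<close>, the setting in which \<open>truncate\<close> works.\<close>

definition zero_extension :: "'i set \<Rightarrow> ('i \<Rightarrow> real) \<Rightarrow> 'i \<Rightarrow> real" where
  "zero_extension I x = (\<lambda>i. if i \<in> I then x i else 0)"

lemma continuous_map_fun_componentwise:
  "continuous_map X euclidean (c :: 'a \<Rightarrow> 'i \<Rightarrow> real) \<longleftrightarrow> (\<forall>i. continuous_map X euclideanreal (\<lambda>x. c x i))"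
  unfolding euclidean_product_topology[symmetric] continuous_map_componentwise_UNIV ..

lemma embedding_map_imp_continuous_map:
  assumes "embedding_map X Y h" shows "continuous_map X Y h"
  using assms unfolding embedding_map_def
  by (blast dest: homeomorphic_imp_continuous_map continuous_map_into_fulltopology)

lemma embedding_map_continuous_coordinate:
  assumes "embedding_map X (powertop_real I) h" "i \<in> I"
  shows "continuous_map X euclideanreal (\<lambda>x. h x i)"
proof -
  have "continuous_map X (powertop_real I) h"
    using assms(1) by (rule embedding_map_imp_continuous_map)
  then show ?thesis using assms(2) by (auto simp: continuous_map_componentwise)
qed

lemma embedding_map_zero_extension:
  fixes h :: "'a \<Rightarrow> 'i \<Rightarrow> real"
  assumes "compact_space X" and emb: "embedding_map X (powertop_real I) h"
  shows "embedding_map X euclidean (\<lambda>x. zero_extension I (h x))"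
proof (rule continuous_imp_embedding_map)
  show "continuous_map X euclidean (\<lambda>x. zero_extension I (h x))"
    unfolding continuous_map_fun_componentwise zero_extension_def
    using embedding_map_continuous_coordinate[OF emb] by simp
  show "Hausdorff_space (euclidean :: ('i \<Rightarrow> real) topology)"
    unfolding euclidean_product_topology[symmetric] by (simp add: Hausdorff_space_product_topology)
  have inj: "inj_on h (topspace X)"
    using emb by (simp add: embedding_map_def homeomorphic_map_def)
  have hI: "h ` topspace X \<subseteq> topspace (powertop_real I)"
    using emb by (intro continuous_map_image_subset_topspace embedding_map_imp_continuous_map)
  show "inj_on (\<lambda>x. zero_extension I (h x)) (topspace X)"
  proof (rule inj_onI)
    fix x y assume xy: "x \<in> topspace X" "y \<in> topspace X" "zero_extension I (h x) = zero_extension I (h y)"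
    have "h x = h y"
    proof (rule extensionalityI)
      show "h x \<in> extensional I" "h y \<in> extensional I" using hI xy by (auto simp: PiE_iff)
      show "h x i = h y i" if "i \<in> I" for i
        using fun_cong[OF xy(3), of i] that by (simp add: zero_extension_def)
    qed
    then show "x = y" using inj xy by (simp add: inj_on_eq_iff)
  qed
qed fact

lemma closed_image_compact_space:
  assumes "compact_space X" "continuous_map X euclidean (c :: 'a \<Rightarrow> 'i \<Rightarrow> real)"
  shows "compact (c ` topspace X)" "closed (c ` topspace X)"
proof -
  show "compact (c ` topspace X)"
    using image_compactin[of X "topspace X" euclidean c] assms by (simp add: compact_space_def)
  then show "closed (c ` topspace X)" by (rule compact_imp_closed_fun)
qed

lemma image_subset_closure_image:
  assumes "continuous_map X euclidean c" "dense_in X D"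
  shows "c ` topspace X \<subseteq> closure (c ` D)"
  using continuous_map_image_closure_subset[OF assms(1), of D] assms(2) by (simp add: dense_in_def)

section \<open>Points of countable support in Corson compacta and in G-delta sets\<close>

lemma support_zero_extension: "{i. zero_extension I x i \<noteq> 0} = {i \<in> I. x i \<noteq> 0}"
  by (auto simp: zero_extension_def)

text \<open>The embedding with a dense c0 part and the embedding witnessing Corson are unrelated a
  priori. Coupling them over the sum of their index sets transfers countability of supports from the
  second to the first.\<close>

lemma corson_Sigma_set:
  fixes h :: "'a \<Rightarrow> 'i \<Rightarrow> real"
  assumes X: "compact_space X" and "corson X" and emb: "embedding_map X (powertop_real I) h"
    and dense: "dense_in X D" and D: "\<And>d. d \<in> D \<Longrightarrow> h d \<in> Sigma_set I"
    and x: "x \<in> topspace X"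
  shows "h x \<in> Sigma_set I"
proof -
  obtain J :: "('a \<Rightarrow> real) set" and k where
    "embedding_map X (subtopology (powertop_real J) (Sigma_set J)) k"
    using \<open>corson X\<close> unfolding corson_def by blast
  then have embk: "embedding_map X (powertop_real J) k" and k: "k ` topspace X \<subseteq> Sigma_set J"
    by (auto simp: embedding_map_in_subtopology)
  have injk: "inj_on (\<lambda>x. zero_extension J (k x)) (topspace X)"
    using embedding_map_zero_extension[OF X embk] by (simp add: embedding_map_def homeomorphic_map_def)
  \<comment> \<open>Truncating \<open>c x\<close> to a countable closed set that contains the support of \<open>k x\<close> does not change
    its first half, hence not \<open>x\<close>, and so leaves only countably many nonzero coordinates of \<open>h x\<close>.\<close>
  define c :: "'a \<Rightarrow> ('a \<Rightarrow> real) + 'i \<Rightarrow> real" where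
    "c = (\<lambda>x. case_sum (zero_extension J (k x)) (zero_extension I (h x)))"
  have cont: "continuous_map X euclidean c"
    unfolding continuous_map_fun_componentwise
  proof
    fix s
    show "continuous_map X euclideanreal (\<lambda>x. c x s)"
      using embedding_map_continuous_coordinate[OF embk] embedding_map_continuous_coordinate[OF emb]
      by (cases s) (auto simp: c_def zero_extension_def)
  qed
  have "D \<subseteq> topspace X" using dense by (simp add: dense_in_def)
  have supp: "countable {s. z s \<noteq> 0}" if z: "z \<in> c ` D" for z
  proof -
    obtain d where d: "d \<in> D" "z = c d" using z by blast
    have "{s. c d s \<noteq> 0} \<subseteq> Inl ` {j \<in> J. k d j \<noteq> 0} \<union> Inr ` {i \<in> I. h d i \<noteq> 0}"
    proof
      fix s assume "s \<in> {s. c d s \<noteq> 0}"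
      then show "s \<in> Inl ` {j \<in> J. k d j \<noteq> 0} \<union> Inr ` {i \<in> I. h d i \<noteq> 0}"
        by (cases s) (auto simp: c_def zero_extension_def split: if_splits)
    qed
    moreover have "countable {j \<in> J. k d j \<noteq> 0}" "countable {i \<in> I. h d i \<noteq> 0}"
      using k D[OF d(1)] d(1) \<open>D \<subseteq> topspace X\<close> by (auto simp: Sigma_set_def)
    ultimately show ?thesis unfolding d(2)
      by (meson countable_Un countable_image countable_subset)
  qed
  have "c ` D \<subseteq> c ` topspace X" using \<open>D \<subseteq> topspace X\<close> by blast
  then obtain T :: "(('a \<Rightarrow> real) + 'i) list \<Rightarrow> (('a \<Rightarrow> real) + 'i) set" where T: "\<forall>l. countable (T l)"
    "\<forall>M. list_closed T M \<longrightarrow> (\<forall>z\<in>c ` topspace X. truncate M z \<in> c ` topspace X)"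
    using supp truncate_closed_operator[OF closed_image_compact_space(2)[OF X cont] _
        image_subset_closure_image[OF cont dense]] by metis
  define M where "M = list_closure T (Inl ` {j \<in> J. k x j \<noteq> 0})"
  have "countable {j \<in> J. k x j \<noteq> 0}" using k x by (auto simp: Sigma_set_def)
  then have "countable M"
    unfolding M_def using T(1) by (intro countable_list_closure) auto
  have "truncate M (c x) \<in> c ` topspace X"
    using T(2) x by (simp add: M_def list_closed_list_closure)
  then obtain y where y: "y \<in> topspace X" "truncate M (c x) = c y" by blast
  have "zero_extension J (k x) j = zero_extension J (k y) j" for j
  proof (cases "Inl j \<in> M")
    case True
    then show ?thesis using fun_cong[OF y(2), of "Inl j"] by (simp add: truncate_def c_def)
  next
    case False
    then have "j \<notin> {j \<in> J. k x j \<noteq> 0}"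
      using subset_list_closure[of "Inl ` {j \<in> J. k x j \<noteq> 0}" T] unfolding M_def by blast
    then have "zero_extension J (k x) j = 0" by (simp add: zero_extension_def)
    then show ?thesis
      using fun_cong[OF y(2), of "Inl j"] False by (simp add: truncate_def c_def)
  qed
  then have "x = y" using inj_onD[OF injk _ x y(1)] by (simp add: fun_eq_iff)
  then have "zero_extension I (h x) i = 0" if "Inr i \<notin> M" for i
    using fun_cong[OF y(2), of "Inr i"] that by (simp add: truncate_def c_def)
  then have "{i \<in> I. h x i \<noteq> 0} \<subseteq> Inr -` M"
    unfolding support_zero_extension[symmetric] by auto
  moreover have "countable (Inr -` M :: 'i set)"
    using countable_subset[OF image_vimage_subset \<open>countable M\<close>, of Inr]
    by (rule countable_image_inj_on) simp
  ultimately have "countable {i \<in> I. h x i \<noteq> 0}" by (rule countable_subset)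
  moreover have "h x \<in> topspace (powertop_real I)"
    using continuous_map_image_subset_topspace[OF embedding_map_imp_continuous_map[OF emb]] x by blast
  ultimately show ?thesis by (simp add: Sigma_set_def)
qed

text \<open>Only the members of \<open>\<W>\<close> at \<open>p\<close> matter: countably many coordinates of \<open>p\<close> decide membership in
  all of them, and truncating \<open>p\<close> to a countable closed set containing these keeps it in \<open>K\<close>.\<close>

lemma gdelta_meets_Sigma_set:
  assumes X: "compact_space X" and emb: "embedding_map X (powertop_real I) h"
    and dense: "dense_in X D" and D: "\<And>d. d \<in> D \<Longrightarrow> h d \<in> Sigma_set I"
    and p: "p \<in> topspace X" and \<W>: "countable \<W>" "\<And>W. W \<in> \<W> \<Longrightarrow> openin X W \<and> p \<in> W"
  shows "\<exists>a\<in>topspace X. h a \<in> Sigma_set I \<and> (\<forall>W\<in>\<W>. a \<in> W)"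
proof -
  define e where "e = (\<lambda>x. zero_extension I (h x))"
  have embe: "embedding_map X euclidean e"
    unfolding e_def using X emb by (rule embedding_map_zero_extension)
  then have hom: "homeomorphic_map X (top_of_set (e ` topspace X)) e"
    by (simp add: embedding_map_def)
  then have cont: "continuous_map X euclidean e" and inj: "inj_on e (topspace X)"
    using homeomorphic_imp_continuous_map continuous_map_into_fulltopology homeomorphic_map_def by blast+
  have "D \<subseteq> topspace X" using dense by (simp add: dense_in_def)
  have "e ` D \<subseteq> e ` topspace X" using \<open>D \<subseteq> topspace X\<close> by blast
  moreover have "countable {i. z i \<noteq> 0}" if "z \<in> e ` D" for z
    using D that by (auto simp: e_def support_zero_extension Sigma_set_def)
  ultimately obtain T :: "'b list \<Rightarrow> 'b set" where T: "\<forall>l. countable (T l)"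
    "\<forall>M. list_closed T M \<longrightarrow> (\<forall>z\<in>e ` topspace X. truncate M z \<in> e ` topspace X)"
    using truncate_closed_operator[OF closed_image_compact_space(2)[OF X cont] _
        image_subset_closure_image[OF cont dense]] by metis
  have "\<exists>F. finite F \<and> (\<forall>a\<in>topspace X. (\<forall>i\<in>F. e a i = e p i) \<longrightarrow> a \<in> W)" if "W \<in> \<W>" for W
  proof -
    have "openin (top_of_set (e ` topspace X)) (e ` W)"
      using \<W>(2)[OF that] homeomorphic_map_openness_eq[OF hom] by blast
    then obtain A where A: "open A" "e ` W = e ` topspace X \<inter> A"
      by (auto simp: openin_open)
    have "e p \<in> A" using A(2) \<W>(2)[OF that] by blast
    then obtain F \<delta> where F: "finite F" "\<delta> > 0" "{y. \<forall>i\<in>F. dist (y i) (e p i) < \<delta>} \<subseteq> A"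
      by (rule open_fun_box[OF A(1)])
    have "a \<in> W" if a: "a \<in> topspace X" "\<forall>i\<in>F. e a i = e p i" for a
    proof -
      have "e a \<in> {y. \<forall>i\<in>F. dist (y i) (e p i) < \<delta>}" using a(2) F(2) by simp
      then have "e a \<in> e ` W" using F(3) a(1) A(2) by blast
      moreover have "W \<subseteq> topspace X" using \<W>(2)[OF \<open>W \<in> \<W>\<close>] openin_subset by blast
      ultimately show ?thesis using inj a(1) by (meson inj_on_image_mem_iff)
    qed
    then show ?thesis using F(1) by blast
  qed
  then have "\<forall>W\<in>\<W>. \<exists>F. finite F \<and> (\<forall>a\<in>topspace X. (\<forall>i\<in>F. e a i = e p i) \<longrightarrow> a \<in> W)" by blast
  from bchoice[OF this] obtain F where
    F: "\<forall>W\<in>\<W>. finite (F W) \<and> (\<forall>a\<in>topspace X. (\<forall>i\<in>F W. e a i = e p i) \<longrightarrow> a \<in> W)"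
    by (elim exE)
  define M where "M = list_closure T (\<Union>W\<in>\<W>. F W)"
  have "countable (\<Union>W\<in>\<W>. F W)"
    using \<W>(1) F by (intro countable_UN) (auto intro: countable_finite)
  then have "countable M"
    unfolding M_def using T(1) by (intro countable_list_closure) auto
  have "truncate M (e p) \<in> e ` topspace X"
    using T(2) p by (simp add: M_def list_closed_list_closure)
  then obtain a where a: "a \<in> topspace X" "truncate M (e p) = e a" by blast
  have "e a i = e p i" if "W \<in> \<W>" "i \<in> F W" for W i
  proof -
    have "i \<in> M" using that subset_list_closure[of "\<Union>W\<in>\<W>. F W" T] unfolding M_def by blast
    then show ?thesis unfolding a(2)[symmetric] by (simp add: truncate_def)
  qed
  then have "\<forall>W\<in>\<W>. a \<in> W" using F a(1) by blast
  moreover have "{i \<in> I. h a i \<noteq> 0} \<subseteq> M"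
  proof -
    have "e a i = 0" if "i \<notin> M" for i
      unfolding a(2)[symmetric] using that by (simp add: truncate_def)
    then show ?thesis unfolding support_zero_extension[symmetric] e_def by blast
  qed
  then have "countable {i \<in> I. h a i \<noteq> 0}" using \<open>countable M\<close> by (rule countable_subset)
  moreover have "h a \<in> topspace (powertop_real I)"
    using continuous_map_image_subset_topspace[OF embedding_map_imp_continuous_map[OF emb]] a(1) by blast
  ultimately show ?thesis using a(1) by (auto simp: Sigma_set_def)
qed

text \<open>The common core of both cases, which differ only in how \<open>approx\<close> is
  verified. It makes the fibre relation invariant under truncations, and the resulting separating
  family descends to \<open>L\<close>.\<close>

lemma semi_Eberlein_continuous_image:
  fixes h :: "'a \<Rightarrow> 'i \<Rightarrow> real"
  assumes K: "compact_space K" and emb: "embedding_map K (powertop_real I) h"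
    and dense: "dense_in K {x \<in> topspace K. h x \<in> c0_set I}"
    and L: "tychonoff_space L" and f: "continuous_map K L f" "f ` topspace K = topspace L"
    and approx: "\<And>x y F \<delta>. x \<in> topspace K \<Longrightarrow> y \<in> topspace K \<Longrightarrow> f x = f y \<Longrightarrow> finite F \<Longrightarrow> F \<subseteq> I \<Longrightarrow>
      \<delta> > 0 \<Longrightarrow> \<exists>a\<in>topspace K. \<exists>b\<in>topspace K. f a = f b \<and> h a \<in> Sigma_set I \<and> h b \<in> Sigma_set I \<and>
        (\<forall>i\<in>F. \<bar>h a i - h x i\<bar> < \<delta> \<and> \<bar>h b i - h y i\<bar> < \<delta>)"
  shows "semi_Eberlein L"
proof -
  define e where "e = (\<lambda>x. zero_extension I (h x))"
  define Q where "Q = e ` topspace K"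
  have embe: "embedding_map K euclidean e"
    unfolding e_def using K emb by (rule embedding_map_zero_extension)
  then have "homeomorphic_map K (top_of_set Q) e"
    by (simp add: embedding_map_def Q_def)
  then obtain p where p: "homeomorphic_maps K (top_of_set Q) e p"
    by (auto simp: homeomorphic_map_maps)
  have conte: "continuous_map K euclidean e" using embe by (rule embedding_map_imp_continuous_map)
  have contp: "continuous_map (top_of_set Q) K p" and pe: "\<And>x. x \<in> topspace K \<Longrightarrow> p (e x) = x"
    using p by (simp_all add: homeomorphic_maps_def)
  have eQ: "e x \<in> Q" if "x \<in> topspace K" for x using that by (simp add: Q_def)
  have pK: "p z \<in> topspace K" "e (p z) = z" if "z \<in> Q" for z
    using that pe by (auto simp: Q_def)
  define E where "E = (\<lambda>z w. f (p z) = f (p w))"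
  have Haus: "Hausdorff_space L" using L by (simp add: tychonoff_space_def)
  have compL: "compact_space L"
    using image_compactin[of K "topspace K" L f] K f by (simp add: compact_space_def)
  have "\<exists>T. retractive_compact Q E T"
  proof (rule ex_retractive_compact)
    show "compact Q" unfolding Q_def using K conte by (rule closed_image_compact_space)
    show "E x x" for x by (simp add: E_def)
  next
    fix x y assume xy: "x \<in> Q" "y \<in> Q" "\<not> E x y"
    have "closedin L {f (p y)}"
      using Hausdorff_imp_t1_space[OF Haus] f(2) pK(1)[OF xy(2)] by (auto simp: t1_space_closedin_singleton)
    moreover have "f (p x) \<in> topspace L - {f (p y)}"
      using xy f(2) pK(1)[OF xy(1)] by (auto simp: E_def)
    ultimately obtain g where g: "continuous_map L (top_of_set {0..1::real}) g" "g (f (p x)) = 0" "g ` {f (p y)} \<subseteq> {1}"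
      using L unfolding tychonoff_space_def completely_regular_space_def by metis
    have "continuous_map (top_of_set Q) euclideanreal (g \<circ> (f \<circ> p))"
      using continuous_map_into_fulltopology[OF g(1)] f(1) contp
      by (intro continuous_map_compose)
    then have "continuous_on Q (\<lambda>z. g (f (p z)))" by (simp add: o_def)
    then show "\<exists>u. continuous_on Q u \<and> (\<forall>a\<in>Q. \<forall>b\<in>Q. E a b \<longrightarrow> u a = u b) \<and> u x \<noteq> (u y :: real)"
      using g(2,3) by (intro exI[of _ "\<lambda>z. g (f (p z))"]) (auto simp: E_def)
  next
    fix x y and F :: "'i set" and \<delta> :: real assume xy: "x \<in> Q" "y \<in> Q" "E x y" and F: "finite F" "\<delta> > 0"
    have "finite (F \<inter> I)" "F \<inter> I \<subseteq> I" using F by auto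
    from approx[OF pK(1)[OF xy(1)] pK(1)[OF xy(2)] _ this F(2)] xy(3) obtain a b where
      ab: "a \<in> topspace K" "b \<in> topspace K" "f a = f b" "h a \<in> Sigma_set I" "h b \<in> Sigma_set I"
        "\<forall>i\<in>F \<inter> I. \<bar>h a i - h (p x) i\<bar> < \<delta> \<and> \<bar>h b i - h (p y) i\<bar> < \<delta>"
      unfolding E_def by blast
    have x: "x i = (if i \<in> I then h (p x) i else 0)" for i
      using fun_cong[OF pK(2)[OF xy(1)], of i] by (simp add: e_def zero_extension_def)
    have y: "y i = (if i \<in> I then h (p y) i else 0)" for i
      using fun_cong[OF pK(2)[OF xy(2)], of i] by (simp add: e_def zero_extension_def)
    have "\<forall>i\<in>F. \<bar>e a i - x i\<bar> < \<delta> \<and> \<bar>e b i - y i\<bar> < \<delta>"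
    proof
      fix i assume "i \<in> F"
      then show "\<bar>e a i - x i\<bar> < \<delta> \<and> \<bar>e b i - y i\<bar> < \<delta>"
        using ab(6) F(2) x[of i] y[of i] by (cases "i \<in> I") (simp_all add: e_def zero_extension_def)
    qed
    moreover have "countable {i. e a i \<noteq> 0}" "countable {i. e b i \<noteq> 0}"
      using ab(4,5) by (simp_all add: e_def support_zero_extension Sigma_set_def)
    moreover have "E (e a) (e b)" using ab(1-3) by (simp add: E_def pe)
    ultimately show "\<exists>a\<in>Q. \<exists>b\<in>Q. E a b \<and> countable {i. a i \<noteq> 0} \<and> countable {i. b i \<noteq> 0} \<and>
        (\<forall>i\<in>F. \<bar>a i - x i\<bar> < \<delta> \<and> \<bar>b i - y i\<bar> < \<delta>)"
      using eQ[OF ab(1)] eQ[OF ab(2)] by blast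
  qed
  then obtain T where "retractive_compact Q E T" by (elim exE)
  then interpret retractive_compact Q E T .
  \<comment> \<open>Truncation to the closure of \<open>UNIV\<close> is the identity, so this
    \<open>G\<close> separates all fibres.\<close>
  obtain G where "adequate UNIV G" using ex_adequate[of UNIV] by (elim exE)
  moreover have "list_closure T UNIV = UNIV"
    using subset_list_closure[of UNIV T] by blast
  ultimately have G: "\<And>u. u \<in> G \<Longrightarrow> invariant u" "sigma_small G"
    and sepG: "\<And>x y. x \<in> Q \<Longrightarrow> y \<in> Q \<Longrightarrow> \<forall>u\<in>G. u x = u y \<Longrightarrow> E x y"
    unfolding adequate_def by simp_all
  \<comment> \<open>Any section will do: members of \<open>G\<close> are constant on fibres, and
    continuity on \<open>L\<close> comes from \<open>f\<close> being a quotient map.\<close>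
  define s where "s = (\<lambda>y. SOME x. x \<in> topspace K \<and> f x = y)"
  have s: "s y \<in> topspace K" "f (s y) = y" if "y \<in> topspace L" for y
  proof -
    have "\<exists>x. x \<in> topspace K \<and> f x = y" using that f(2) by (metis imageE)
    from someI_ex[OF this] show "s y \<in> topspace K" "f (s y) = y" by (simp_all add: s_def)
  qed
  define push where "push = (\<lambda>u y. u (e (s y)) :: real)"
  have push: "push u (f x) = u (e x)" if u: "u \<in> G" and x: "x \<in> topspace K" for u x
  proof -
    have fx: "f x \<in> topspace L" using x f(2) by blast
    have "E (e (s (f x))) (e x)" using s[OF fx] x by (simp add: E_def pe)
    then show ?thesis
      using G(1)[OF u] eQ[OF x] eQ[OF s(1)[OF fx]] unfolding invariant_def push_def by blast
  qed
  have quot: "quotient_map K L f"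
    using f K Haus by (intro continuous_imp_quotient_map)
  let ?D = "{x \<in> topspace K. h x \<in> c0_set I}"
  show ?thesis
  proof (rule semi_Eberlein_functions[OF compL, where D = "f ` ?D" and H = "push ` G"])
    have "f ` topspace K \<subseteq> L closure_of (f ` ?D)"
      using continuous_map_image_closure_subset[OF f(1), of ?D] dense by (simp add: dense_in_def)
    then show "dense_in L (f ` ?D)"
      unfolding dense_in_def f(2) using closure_of_subset_topspace[of L] f(2) by blast
  next
    fix v assume "v \<in> push ` G"
    then obtain u where u: "u \<in> G" "v = push u" by blast
    have "continuous_map (top_of_set Q) euclideanreal u"
      using G(1)[OF u(1)] by (simp add: invariant_def)
    moreover have "continuous_map K (top_of_set Q) e"
      using p by (simp add: homeomorphic_maps_def)
    ultimately have "continuous_map K euclideanreal (u \<circ> e)" by (rule continuous_map_compose[rotated])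
    then have "continuous_map K euclideanreal (v \<circ> f)"
      by (rule continuous_map_eq) (simp add: u push)
    then show "continuous_map L euclideanreal v"
      using quot by (simp add: continuous_compose_quotient_map_eq[symmetric])
  next
    fix x y assume xy: "x \<in> topspace L" "y \<in> topspace L" "\<forall>v\<in>push ` G. v x = v y"
    then have "\<forall>u\<in>G. u (e (s x)) = u (e (s y))" by (simp add: push_def)
    then have "E (e (s x)) (e (s y))" using sepG s xy eQ by blast
    then show "x = y" using s[OF xy(1)] s[OF xy(2)] by (simp add: E_def pe)
  next
    fix \<epsilon> :: real assume "\<epsilon> > 0"
    with G(2) obtain C :: "nat \<Rightarrow> (('i \<Rightarrow> real) \<Rightarrow> real) set" where C: "G \<subseteq> (\<Union>n. C n)"
      "\<forall>n. \<forall>d\<in>c0_points. finite {u \<in> C n. \<bar>u d\<bar> > \<epsilon>}"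
      by (rule sigma_smallE)
    \<comment> \<open>The classes are cut down to \<open>G\<close> because only its members are
      known to satisfy \<open>push u (f x) = u (e x)\<close>.\<close>
    have "push ` G \<subseteq> (\<Union>n. push ` (C n \<inter> G))" using C(1) by blast
    moreover have "finite {v \<in> push ` (C n \<inter> G). \<bar>v d\<bar> > \<epsilon>}" if d: "d \<in> f ` ?D" for n d
    proof -
      obtain x where x: "x \<in> topspace K" "h x \<in> c0_set I" "d = f x" using d by blast
      have "finite {i. \<bar>e x i\<bar> > \<eta>}" if "\<eta> > 0" for \<eta>
      proof (rule finite_subset)
        show "{i. \<bar>e x i\<bar> > \<eta>} \<subseteq> {i \<in> I. \<bar>h x i\<bar> > \<eta>}"
          using that by (auto simp: e_def zero_extension_def split: if_splits)
        show "finite {i \<in> I. \<bar>h x i\<bar> > \<eta>}" using x(2) that by (simp add: c0_set_def)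
      qed
      then have "e x \<in> c0_points" using eQ[OF x(1)] by (simp add: c0_points_def)
      then have "finite {u \<in> C n. \<bar>u (e x)\<bar> > \<epsilon>}" using C(2) by blast
      moreover have "{v \<in> push ` (C n \<inter> G). \<bar>v d\<bar> > \<epsilon>} \<subseteq> push ` {u \<in> C n. \<bar>u (e x)\<bar> > \<epsilon>}"
        using push x by auto
      ultimately show ?thesis by (meson finite_imageI finite_subset)
    qed
    ultimately show "\<exists>C :: nat \<Rightarrow> ('b \<Rightarrow> real) set. push ` G \<subseteq> (\<Union>n. C n) \<and>
        (\<forall>n. \<forall>d\<in>f ` ?D. finite {v \<in> C n. \<bar>v d\<bar> > \<epsilon>})"
      by (intro exI[of _ "\<lambda>n. push ` (C n \<inter> G)"] conjI allI ballI)
  qed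
qed

section \<open>The two cases: open images and images of Corson compacta\<close>

theorem theorem3:
  fixes K :: "'a topology" and L :: "'b topology"
  assumes "tychonoff_space K" and "tychonoff_space L"
    and "semi_Eberlein K"
  shows "((\<exists>f. continuous_map K L f \<and> open_map K L f \<and> f ` topspace K = topspace L) \<and>
          dense_in L {x \<in> topspace L. gdelta_in L {x}} \<longrightarrow> semi_Eberlein L) \<and>
         (corson K \<and> (\<exists>f. continuous_map K L f \<and> f ` topspace K = topspace L) \<longrightarrow>
          semi_Eberlein L)"
proof -
  have K: "compact_space K" using assms(3) by (simp add: semi_Eberlein_def)
  obtain I :: "('a \<Rightarrow> real) set" and h where emb: "embedding_map K (powertop_real I) h"
    and dense: "dense_in K {x \<in> topspace K. h x \<in> c0_set I}"
    using assms(3) unfolding semi_Eberlein_def by (elim conjE exE)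
  let ?D = "{x \<in> topspace K. h x \<in> c0_set I}"
  have D: "h d \<in> Sigma_set I" if "d \<in> ?D" for d
    using that c0_set_subset_Sigma_set by blast
  have "semi_Eberlein L"
    if f: "continuous_map K L f" "open_map K L f" "f ` topspace K = topspace L"
      and G: "dense_in L {x \<in> topspace L. gdelta_in L {x}}" for f
  proof (rule semi_Eberlein_continuous_image[OF K emb dense assms(2) f(1,3)])
    fix x y and F :: "('a \<Rightarrow> real) set" and \<delta> :: real
    assume xy: "x \<in> topspace K" "y \<in> topspace K" "f x = f y" and F: "finite F" "F \<subseteq> I" "\<delta> > 0"
    define U where "U = (\<lambda>x. {z \<in> topspace K. \<forall>i\<in>F. \<bar>h z i - h x i\<bar> < \<delta>})"
    have U: "openin K (U x)" for x
    proof -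
      have "openin K {z \<in> topspace K. h z i \<in> ball (h x i) \<delta>}" if "i \<in> F" for i
        using embedding_map_continuous_coordinate[OF emb, of i] that F(2)
        by (intro openin_continuous_map_preimage[where Y = euclideanreal]) auto
      then have "openin K ((\<Inter>i\<in>F. {z \<in> topspace K. h z i \<in> ball (h x i) \<delta>}) \<inter> topspace K)"
        using F(1) by (intro openin_INT)
      moreover have "U x = (\<Inter>i\<in>F. {z \<in> topspace K. h z i \<in> ball (h x i) \<delta>}) \<inter> topspace K"
        by (auto simp: U_def dist_real_def abs_minus_commute)
      ultimately show ?thesis by simp
    qed
    \<comment> \<open>Openness of \<open>f\<close> makes this a neighbourhood of the common value
      \<open>f x = f y\<close>, so it contains a G-delta point \<open>z\<close>.\<close>
    have "openin L (f ` U x \<inter> f ` U y)"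
      using f(2) U by (auto simp: open_map_def intro!: openin_Int)
    moreover have "x \<in> U x" "y \<in> U y"
      using xy F(3) by (simp_all add: U_def)
    then have "f x \<in> f ` U x \<inter> f ` U y"
      using imageI[of x "U x" f] imageI[of y "U y" f] xy(3) by simp
    moreover have "f x \<in> L closure_of {x \<in> topspace L. gdelta_in L {x}}"
      using G xy(1) f(3) by (auto simp: dense_in_def)
    ultimately have "\<exists>z. z \<in> {x \<in> topspace L. gdelta_in L {x}} \<and> z \<in> f ` U x \<inter> f ` U y"
      unfolding in_closure_of by presburger
    then obtain z where z: "gdelta_in L {z}" "z \<in> f ` U x" "z \<in> f ` U y"
      by auto
    obtain \<O> where \<O>: "countable \<O>" "\<And>V. V \<in> \<O> \<Longrightarrow> openin L V" "\<Inter>\<O> = {z}"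
      using z(1) unfolding gdelta_in_alt intersection_of_def by auto
    \<comment> \<open>The fibre of \<open>z\<close> is a G-delta set, and so is its nonempty
      intersection with \<open>U x\<close>; such a set contains a point with countable
      support.\<close>
    have pick: "\<exists>a\<in>U x. h a \<in> Sigma_set I \<and> f a = z" if zx: "z \<in> f ` U x" for x
    proof -
      obtain c where c: "c \<in> U x" "f c = z" using zx by blast
      define \<W> where "\<W> = insert (U x) ((\<lambda>V. {w \<in> topspace K. f w \<in> V}) ` \<O>)"
      have cK: "c \<in> topspace K" using c(1) by (simp add: U_def)
      have "countable \<W>" using \<O>(1) by (simp add: \<W>_def)
      moreover have "openin K W \<and> c \<in> W" if "W \<in> \<W>" for W
        using that U c cK \<O>(2,3) openin_continuous_map_preimage[OF f(1)] by (auto simp: \<W>_def)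
      ultimately obtain a where a: "a \<in> topspace K" "h a \<in> Sigma_set I" "\<forall>W\<in>\<W>. a \<in> W"
        using gdelta_meets_Sigma_set[OF K emb dense D cK, of \<W>] by blast
      have "f a \<in> \<Inter>\<O>" using a(3) by (auto simp: \<W>_def)
      then show ?thesis using a \<O>(3) by (auto simp: \<W>_def)
    qed
    obtain a b where "a \<in> U x" "h a \<in> Sigma_set I" "f a = z" "b \<in> U y" "h b \<in> Sigma_set I" "f b = z"
      using pick[OF z(2)] pick[OF z(3)] by blast
    then show "\<exists>a\<in>topspace K. \<exists>b\<in>topspace K. f a = f b \<and> h a \<in> Sigma_set I \<and> h b \<in> Sigma_set I \<and>
        (\<forall>i\<in>F. \<bar>h a i - h x i\<bar> < \<delta> \<and> \<bar>h b i - h y i\<bar> < \<delta>)"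
      by (intro bexI[of _ a] bexI[of _ b]) (auto simp: U_def)
  qed
  moreover have "semi_Eberlein L"
    if "corson K" and f: "continuous_map K L f" "f ` topspace K = topspace L" for f
  proof (rule semi_Eberlein_continuous_image[OF K emb dense assms(2) f])
    fix x y and F :: "('a \<Rightarrow> real) set" and \<delta> :: real
    assume xy: "x \<in> topspace K" "y \<in> topspace K" "f x = f y" and "\<delta> > 0"
    \<comment> \<open>Every point has countable support, so \<open>x\<close> and \<open>y\<close>
      serve as their own approximations.\<close>
    have "h z \<in> Sigma_set I" if "z \<in> topspace K" for z
      using corson_Sigma_set[OF K \<open>corson K\<close> emb dense D that] .
    then show "\<exists>a\<in>topspace K. \<exists>b\<in>topspace K. f a = f b \<and> h a \<in> Sigma_set I \<and> h b \<in> Sigma_set I \<and>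
        (\<forall>i\<in>F. \<bar>h a i - h x i\<bar> < \<delta> \<and> \<bar>h b i - h y i\<bar> < \<delta>)"
      using xy \<open>\<delta> > 0\<close> by (intro bexI[of _ x] bexI[of _ y]) auto
  qed
  ultimately show ?thesis by blast
qed

end
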